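(* Let $d\ge3$ be an integer and $s>\frac d2-\frac14$. There is a constant $C=C(d,s)$ such that for all $u_0\in\mathcal{S}(\mathbb{R}^d)$, $$\|U(t)u_0\|_{L^4_xL^\infty_{y,t}}\le C\|u_0\|_{H^s(\mathbb{R}^d)}.$$
   Context: Points of $\mathbb{R}^d$ are written $(x,y)$ with $x\in\mathbb{R}$, $y\in\mathbb{R}^{d-1}$, with dual frequencies $(\xi,\eta)$. $U(t)$ is given by $\widehat{U(t)u_0}(\xi,\eta)=e^{it\xi(\xi^2+|\eta|^2)}\widehat{u_0}(\xi,\eta)$ (the group of $\partial_tu+\partial_x\Delta u=0$). $\|F\|_{L^4_xL^\infty_{y,t}}=\big(\int_{\mathbb{R}}\sup_{y\in\mathbb{R}^{d-1},\,t\in\mathbb{R}}|F(x,y,t)|^4\,dx\big)^{1/4}$, and $H^s(\mathbb{R}^d)$ is the inhomogeneous Sobolev space. *)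

theory Defs
  imports "HOL-Analysis.Analysis"
begin

fun iter_partial :: "'a::euclidean_space list \<Rightarrow> ('a \<Rightarrow> complex) \<Rightarrow> 'a \<Rightarrow> complex" where
  "iter_partial [] f = f"
| "iter_partial (b # bs) f = (\<lambda>z. frechet_derivative (iter_partial bs f) (at z) b)"

text \<open>
  Requiring every iterated partial derivative to be Frechet differentiable everywhere says that
  \<open>f\<close> is infinitely differentiable, and makes all the values of \<^const>\<open>frechet_derivative\<close> in
  \<^const>\<open>iter_partial\<close> genuine.
\<close>

definition schwartz :: "('a::euclidean_space \<Rightarrow> complex) \<Rightarrow> bool" where
  "schwartz f \<longleftrightarrow>
     (\<forall>bs. set bs \<subseteq> Basis \<longrightarrow>
        (\<forall>z. iter_partial bs f differentiable (at z)) \<and>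
        (\<forall>k::nat. bounded (range (\<lambda>z. (norm z ^ k) *\<^sub>R iter_partial bs f z))))"

text \<open>
  The sign in the exponent is the one for which differentiation in \<open>x\<close> becomes multiplication by
  \<open>\<i>\<xi>\<close>, so that the symbol of \<open>-\<partial>\<^sub>x\<Delta>\<close> is \<open>\<i>\<xi>(\<xi>\<^sup>2 + \<bar>\<eta>\<bar>\<^sup>2)\<close>.
\<close>

definition fourier :: "('a::euclidean_space \<Rightarrow> complex) \<Rightarrow> 'a \<Rightarrow> complex" where
  "fourier f \<zeta> = (\<integral>z. exp (- \<i> * complex_of_real (z \<bullet> \<zeta>)) * f z \<partial>lborel)"

definition inv_fourier :: "('a::euclidean_space \<Rightarrow> complex) \<Rightarrow> 'a \<Rightarrow> complex" where
  "inv_fourier g z =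
     complex_of_real (1 / (2 * pi) ^ DIM('a)) *
       (\<integral>\<zeta>. exp (\<i> * complex_of_real (z \<bullet> \<zeta>)) * g \<zeta> \<partial>lborel)"

text \<open>
  Points of \<open>\<real>\<^sup>d\<close> are pairs \<open>(x, y)\<close>, with the Euclidean norm and inner product
  of the product type.
\<close>

definition U :: "real \<Rightarrow> (real \<times> (real ^ 'n) \<Rightarrow> complex) \<Rightarrow> real \<times> (real ^ 'n) \<Rightarrow> complex" where
  "U t u0 = inv_fourier (\<lambda>(\<xi>, \<eta>).
     exp (\<i> * complex_of_real (t * \<xi> * (\<xi>\<^sup>2 + (norm \<eta>)\<^sup>2))) * fourier u0 (\<xi>, \<eta>))"

definition ennroot :: "nat \<Rightarrow> ennreal \<Rightarrow> ennreal" where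
  "ennroot n a = (if a = top then top else ennreal (root n (enn2real a)))"

definition L4x_Linf_yt_norm :: "(real \<Rightarrow> real ^ 'n \<Rightarrow> real \<Rightarrow> complex) \<Rightarrow> ennreal" where
  "L4x_Linf_yt_norm F =
     ennroot 4 (\<integral>\<^sup>+x. (SUP y. SUP t. ennreal (norm (F x y t) ^ 4)) \<partial>lborel)"

definition sobolev_norm :: "real \<Rightarrow> ('a::euclidean_space \<Rightarrow> complex) \<Rightarrow> ennreal" where
  "sobolev_norm s f =
     ennroot 2 (\<integral>\<^sup>+\<zeta>. ennreal ((1 + (norm \<zeta>)\<^sup>2) powr s * (norm (fourier f \<zeta>))\<^sup>2) \<partial>lborel)"

end

theory Submission
  imports Defs "HOL-Probability.Characteristic_Functions" "HOL-Real_Asymp.Real_Asymp"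
begin

text \<open>
  The proof is a \<open>TT\<^sup>*\<close> argument with Gaussian frequency cutoffs in place of a
  Littlewood--Paley decomposition. The kernel
  \<open>K(x, y, t) = \<integral> exp (\<i>(x\<xi> + y\<cdot>\<eta> + t\<xi>\<bar>\<zeta>\<bar>\<^sup>2) - \<bar>\<zeta>\<bar>\<^sup>2) d\<zeta>\<close>
  is \<open>O(\<bar>t\<bar> powr -\<theta>)\<close> for every \<open>\<theta> < 1\<close>: for fixed \<open>\<xi>\<close> the \<open>\<eta>\<close>-integral is a
  Gaussian chirp in at least two dimensions, of size \<open>(1 + t\<^sup>2\<xi>\<^sup>2) powr -1/2\<close>. Two integrations
  by parts in \<open>\<xi>\<close> give \<open>O((1 + \<bar>t\<bar>)\<^sup>2 / x\<^sup>2)\<close>. Together,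
  \<open>\<bar>K(x, y, t)\<bar> \<le> C min 1 (\<bar>x\<bar> powr -4/7)\<close> uniformly in \<open>y\<close> and \<open>t\<close>, which is in
  \<open>L\<^sup>2\<close>, so Young's inequality maps the Lebesgue space of exponent \<open>4/3\<close> to \<open>L\<^sup>4\<close>. Rescaling to the cutoff
  \<open>exp (-\<tau>\<bar>\<zeta>\<bar>\<^sup>2)\<close> costs \<open>\<tau> powr -(d/2 - 1/4)\<close>, and the Gamma integral
  assembles the Sobolev weight from these cutoffs.
\<close>

section \<open>Gaussian chirps\<close>

text \<open>The dimension enters through the admissible rates \<theta>. A chirp in d - 1 variables
  decays like |t \<xi>| powr -(d-1)/2, while |\<xi>| powr -\<theta> must stay integrable at \<xi> =
  0, so \<theta> < 1 is the limit however large d is. Balancing |t| powr -\<theta> against t^2 / x^2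
  along |t| = |x| powr (2/(2+\<theta>)) leaves the decay |x| powr -(2\<theta>/(2+\<theta>)), which
  is square integrable at infinity exactly for \<theta> > 2/3. For d = 2 the chirp would give only
  \<theta> = 1/2; for d \<ge> 3 the whole range \<theta> < 1 is available. A Gaussian cutoff suits
  every step: it factors over coordinates, it makes all integrals over frequency absolutely
  convergent, so orders of integration can be exchanged, and together with the homogeneous phase it
  reduces all scales to a single kernel. The supremum over (y, t) is never handled directly. It is
  replaced by a measurable choice of (y, t) for each x, and the kernel bounds, being uniform in y
  and t, do not see which choice was made.\<close>

lemma gauss_integrable:
  fixes c :: real
  assumes "c > 0"
  shows "integrable lborel (\<lambda>w::real. exp (- c * w\<^sup>2))"
proof -
  have "integrable lborel (\<lambda>w. sqrt (pi / c) * normal_density 0 (sqrt (1 / (2 * c))) w)"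
    using assms by (intro integrable_mult_right integrable_normal_density) auto
  also have "(\<lambda>w. sqrt (pi / c) * normal_density 0 (sqrt (1 / (2 * c))) w) = (\<lambda>w::real. exp (- c * w\<^sup>2))"
    using assms by (auto simp: normal_density_def real_sqrt_divide real_sqrt_mult fun_eq_iff field_simps)
  finally show ?thesis .
qed

lemma gauss_integral:
  fixes c :: real
  assumes "c > 0"
  shows "(\<integral>w. exp (- c * (w::real)\<^sup>2) \<partial>lborel) = sqrt (pi / c)"
proof -
  have "(\<lambda>w. sqrt (pi / c) * normal_density 0 (sqrt (1 / (2 * c))) w) = (\<lambda>w::real. exp (- c * w\<^sup>2))"
    using assms by (auto simp: normal_density_def real_sqrt_divide real_sqrt_mult fun_eq_iff field_simps)
  then have "(\<integral>w. exp (- c * (w::real)\<^sup>2) \<partial>lborel)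
      = (\<integral>w. sqrt (pi / c) * normal_density 0 (sqrt (1 / (2 * c))) w \<partial>lborel)" by simp
  also have "\<dots> = sqrt (pi / c)"
    using assms by (simp add: integral_normal_density)
  finally show ?thesis .
qed

lemma gauss_fourier:
  fixes c k :: real
  assumes "c > 0"
  shows "(\<integral>w. exp (- c * (w::real)\<^sup>2) * cis (k * w) \<partial>lborel) = sqrt (pi / c) * exp (- k\<^sup>2 / (4 * c))"
proof -
  \<comment> \<open>The substitution x -> r x turns the standard normal density into a multiple of
    \<open>exp (- c * x^2)\<close>, so the claim is its characteristic function at k / r.\<close>
  define r where "r = sqrt (2 * c)"
  have r: "r > 0" "r\<^sup>2 = 2 * c" using assms by (auto simp: r_def)
  have "complex_of_real (exp (- (k / r)\<^sup>2 / 2)) = char std_normal_distribution (k / r)"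
    by (simp add: char_std_normal_distribution)
  also have "\<dots> = (\<integral>x. std_normal_density x *\<^sub>R cis (k / r * x) \<partial>lborel)"
    unfolding char_def cis_conv_exp by (subst integral_density) (auto simp: mult_ac)
  also have "\<dots> = r *\<^sub>R (\<integral>x. std_normal_density (r * x) *\<^sub>R cis (k / r * (r * x)) \<partial>lborel)"
    using r by (subst lborel_integral_real_affine[where c = r and t = 0]) auto
  also have "(\<integral>x. std_normal_density (r * x) *\<^sub>R cis (k / r * (r * x)) \<partial>lborel)
     = (\<integral>x. complex_of_real (1 / sqrt (2 * pi)) * (exp (- c * x\<^sup>2) * cis (k * x)) \<partial>lborel)"
    using r by (intro Bochner_Integration.integral_cong)
       (auto simp: std_normal_density_def scaleR_conv_of_real power_mult_distrib exp_of_real field_simps)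
  also have "\<dots> = 1 / sqrt (2 * pi) * (\<integral>x. exp (- c * x\<^sup>2) * cis (k * x) \<partial>lborel)"
    by simp
  finally have *: "complex_of_real (exp (- (k / r)\<^sup>2 / 2)) =
     r *\<^sub>R (1 / sqrt (2 * pi) * (\<integral>x. exp (- c * x\<^sup>2) * cis (k * x) \<partial>lborel))" .
  have "complex_of_real (sqrt (2 * pi) / r) * complex_of_real (exp (- (k / r)\<^sup>2 / 2)) =
      (\<integral>x. exp (- c * x\<^sup>2) * cis (k * x) \<partial>lborel)"
    unfolding * using r by (simp add: scaleR_conv_of_real field_simps flip: of_real_mult)
  also have "sqrt (2 * pi) / r = sqrt (pi / c)"
    using assms by (simp add: r_def real_sqrt_divide real_sqrt_mult)
  also have "- (k / r)\<^sup>2 / 2 = - k\<^sup>2 / (4 * c)"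
    using r by (simp add: power_divide)
  finally show ?thesis by simp
qed

lemma integrable_tensor:
  fixes f :: "'a::euclidean_space \<Rightarrow> 'c::{real_normed_field, banach, second_countable_topology}"
    and g :: "'b::euclidean_space \<Rightarrow> 'c"
  assumes f: "integrable lborel f" and g: "integrable lborel g"
  shows "integrable (lborel \<Otimes>\<^sub>M lborel) (\<lambda>(x, y). f x * g y)"
proof (rule lborel_pair.Fubini_integrable)
  have [measurable]: "f \<in> borel_measurable borel" "g \<in> borel_measurable borel"
    using borel_measurable_integrable[OF f] borel_measurable_integrable[OF g] by auto
  show "(\<lambda>(x, y). f x * g y) \<in> borel_measurable (lborel \<Otimes>\<^sub>M lborel)" by measurable
qed (use f g in \<open>auto simp: norm_mult\<close>)

lemma measurable_cnj[measurable]: "cnj \<in> borel_measurable borel"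
  by (intro borel_measurable_continuous_onI continuous_intros)

lemma cis_diff: "cis (p - q) = cis p * cnj (cis q)"
  by (simp add: cis_cnj cis_mult)

lemma norm_square_eq_sum_Basis: "(norm (w::'a::euclidean_space))\<^sup>2 = (\<Sum>i\<in>Basis. (w \<bullet> i)\<^sup>2)"
  unfolding power2_norm_eq_inner by (subst euclidean_inner) (simp add: power2_eq_square)

lemma chirp_integrable:
  "integrable lborel (\<lambda>w::real. exp (- w\<^sup>2) * cis (y * w + b * w\<^sup>2))"
  by (rule Bochner_Integration.integrable_bound[OF gauss_integrable[of 1]])
     (auto simp: norm_mult intro!: borel_measurable_continuous_onI continuous_intros)

text \<open>
  Writing the squared modulus as a double integral and passing to the difference variable
  \<open>u\<close> leaves a Gaussian in the other variable, whose Fourier transform supplies the factor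
  \<open>exp (- b\<^sup>2u\<^sup>2/2)\<close>.
\<close>

lemma chirp_bound:
  "(norm (\<integral>w. exp (- (w::real)\<^sup>2) * cis (y * w + b * w\<^sup>2) \<partial>lborel))\<^sup>2 \<le> pi / sqrt (1 + b\<^sup>2)"
proof -
  define f where "f w = exp (- w\<^sup>2) * cis (y * w + b * w\<^sup>2)" for w :: real
  have f_meas[measurable]: "f \<in> borel_measurable borel"
    unfolding f_def by (intro borel_measurable_continuous_onI continuous_intros)
  have f: "integrable lborel f" unfolding f_def by (rule chirp_integrable)
  have nf: "norm (f w) = exp (- w\<^sup>2)" for w by (simp add: f_def norm_mult)
  define I where "I = integral\<^sup>L lborel f"
  have int2: "integrable (lborel \<Otimes>\<^sub>M lborel) (\<lambda>(u, w). f (w + u/2) * cnj (f (w - u/2)))"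
  proof (rule Bochner_Integration.integrable_bound)
    show "integrable (lborel \<Otimes>\<^sub>M lborel) (\<lambda>(u, w). exp (- (1/2) * u\<^sup>2) * exp (- 2 * (w::real)\<^sup>2))"
      using integrable_tensor[OF gauss_integrable[of "1/2"] gauss_integrable[of 2]] by simp
    have "norm (f (w + u/2) * cnj (f (w - u/2))) = exp (- (1/2) * u\<^sup>2) * exp (- 2 * w\<^sup>2)" for u w
      by (simp add: norm_mult nf exp_add[symmetric] power2_eq_square field_simps)
    then show "AE x in lborel \<Otimes>\<^sub>M lborel. norm (case x of (u, w) \<Rightarrow> f (w + u / 2) * cnj (f (w - u / 2)))
        \<le> norm (case x of (u, w) \<Rightarrow> exp (- (1/2) * u\<^sup>2) * exp (- 2 * w\<^sup>2))"
      by auto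
  qed measurable
  have "complex_of_real ((norm I)\<^sup>2) = I * cnj I" by (rule complex_norm_square)
  also have "\<dots> = (\<integral>w. f w * cnj I \<partial>lborel)" by (simp add: I_def f)
  also have "\<dots> = (\<integral>w. \<integral>u. f w * cnj (f u) \<partial>lborel \<partial>lborel)"
    using f by (simp add: I_def)
  also have "\<dots> = (\<integral>w. \<integral>u. f w * cnj (f (w - u)) \<partial>lborel \<partial>lborel)"
  proof (rule Bochner_Integration.integral_cong[OF refl])
    fix w :: real
    show "(\<integral>u. f w * cnj (f u) \<partial>lborel) = (\<integral>u. f w * cnj (f (w - u)) \<partial>lborel)"
      using lborel_integral_real_affine[where c = "-1" and t = w and f = "\<lambda>u. f w * cnj (f u)"] by simp
  qed
  also have "\<dots> = (\<integral>u. \<integral>w. f w * cnj (f (w - u)) \<partial>lborel \<partial>lborel)"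
  proof (rule lborel_pair.Fubini_integral[symmetric])
    have "integrable (lborel \<Otimes>\<^sub>M lborel) (\<lambda>(w, u). f w * cnj (f (w - u)))"
    proof (rule lborel_pair.Fubini_integrable)
      show "AE x in lborel. integrable lborel (\<lambda>y. case (x, y) of (w, u) \<Rightarrow> f w * cnj (f (w - u)))"
      proof (intro AE_I2)
        fix w
        have "integrable lborel (\<lambda>u. cnj (f (w + (-1) * u)))"
          using lborel_integrable_real_affine[of "\<lambda>u. cnj (f u)" "-1" w] f by auto
        then show "integrable lborel (\<lambda>y. case (w, y) of (w, u) \<Rightarrow> f w * cnj (f (w - u)))"
          by simp
      qed
      have "(\<integral>y. norm (f w * cnj (f (w - y))) \<partial>lborel) = exp (- w\<^sup>2) * sqrt pi" for w
      proof -
        have "(\<integral>y. norm (f w * cnj (f (w - y))) \<partial>lborel) = exp (- w\<^sup>2) * (\<integral>y. exp (- (w + (-1) * y)\<^sup>2) \<partial>lborel)"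
          by (simp add: norm_mult nf)
        also have "(\<integral>y. exp (- (w + (-1) * y)\<^sup>2) \<partial>lborel) = sqrt pi"
          using gauss_integral[of 1] lborel_integral_real_affine[where c = "-1" and t = w and f = "\<lambda>y::real. exp (- y\<^sup>2)"]
          by simp
        finally show ?thesis .
      qed
      then show "integrable lborel (\<lambda>x. \<integral>y. norm (case (x, y) of (w, u) \<Rightarrow> f w * cnj (f (w - u))) \<partial>lborel)"
        using gauss_integrable[of 1] by simp
    qed measurable
    then show "integrable (lborel \<Otimes>\<^sub>M lborel) (\<lambda>(u, w). f u * cnj (f (u - w)))" .
  qed
  \<comment> \<open>The symmetric shift decouples the variables: the weights multiply to
    \<open>exp (- u^2 / 2) * exp (- 2 * w^2)\<close>, and the two quadratic phases differ by
    \<open>2 * b * u * w\<close>, which is linear in w.\<close>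
  also have "\<dots> = (\<integral>u. \<integral>w. f (w + u/2) * cnj (f (w - u/2)) \<partial>lborel \<partial>lborel)"
  proof (rule Bochner_Integration.integral_cong[OF refl])
    fix u :: real
    have "(\<integral>w. f w * cnj (f (w - u)) \<partial>lborel) = (\<integral>w. f (u/2 + 1 * w) * cnj (f ((u/2 + 1 * w) - u)) \<partial>lborel)"
      by (subst lborel_integral_real_affine[where c = 1 and t = "u/2"]) auto
    then show "(\<integral>w. f w * cnj (f (w - u)) \<partial>lborel) = (\<integral>w. f (w + u/2) * cnj (f (w - u/2)) \<partial>lborel)"
      by (simp add: add.commute diff_add_eq)
  qed
  also have "\<dots> = (\<integral>u. of_real (exp (- u\<^sup>2 / 2)) * cis (y * u) * of_real (sqrt (pi / 2) * exp (- b\<^sup>2 * u\<^sup>2 / 2)) \<partial>lborel)"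
  proof (rule Bochner_Integration.integral_cong[OF refl])
    fix u :: real
    have "f (w + u/2) * cnj (f (w - u/2))
        = (of_real (exp (- u\<^sup>2 / 2)) * cis (y * u)) * (of_real (exp (- 2 * w\<^sup>2)) * cis ((2 * b * u) * w))" for w
    proof -
      have "f (w + u/2) * cnj (f (w - u/2))
         = of_real (exp (- (w + u/2)\<^sup>2) * exp (- (w - u/2)\<^sup>2)) *
           cis ((y * (w + u/2) + b * (w + u/2)\<^sup>2) - (y * (w - u/2) + b * (w - u/2)\<^sup>2))"
        unfolding cis_diff f_def by simp
      also have "exp (- (w + u/2)\<^sup>2) * exp (- (w - u/2)\<^sup>2) = exp (- u\<^sup>2 / 2) * exp (- 2 * w\<^sup>2)"
        unfolding exp_add[symmetric] by (simp add: power2_eq_square field_simps)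
      also have "(y * (w + u/2) + b * (w + u/2)\<^sup>2) - (y * (w - u/2) + b * (w - u/2)\<^sup>2)
         = y * u + (2 * b * u) * w"
        by (simp add: power2_eq_square field_simps)
      finally show ?thesis by (simp add: cis_mult[symmetric])
    qed
    then have "(\<integral>w. f (w + u/2) * cnj (f (w - u/2)) \<partial>lborel) =
       (of_real (exp (- u\<^sup>2 / 2)) * cis (y * u)) * (\<integral>w. of_real (exp (- 2 * w\<^sup>2)) * cis ((2 * b * u) * w) \<partial>lborel)"
      by simp
    also have "(\<integral>w. of_real (exp (- 2 * w\<^sup>2)) * cis ((2 * b * u) * w) \<partial>lborel) = of_real (sqrt (pi / 2) * exp (- b\<^sup>2 * u\<^sup>2 / 2))"
      by (subst gauss_fourier) (auto simp: power_mult_distrib)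
    finally show "(\<integral>w. f (w + u/2) * cnj (f (w - u/2)) \<partial>lborel) =
      of_real (exp (- u\<^sup>2 / 2)) * cis (y * u) * of_real (sqrt (pi / 2) * exp (- b\<^sup>2 * u\<^sup>2 / 2))" by simp
  qed
  finally have "(norm I)\<^sup>2 = norm (\<integral>u. of_real (exp (- u\<^sup>2 / 2)) * cis (y * u) * of_real (sqrt (pi / 2) * exp (- b\<^sup>2 * u\<^sup>2 / 2)) \<partial>lborel)"
    by (metis norm_of_real abs_of_nonneg zero_le_power2)
  \<comment> \<open>Taking absolute values costs nothing in b now, since the gain sits in the real
    factor \<open>exp (- b^2 * u^2 / 2)\<close>.\<close>
  also have "\<dots> \<le> (\<integral>u. norm (of_real (exp (- u\<^sup>2 / 2)) * cis (y * u) * of_real (sqrt (pi / 2) * exp (- b\<^sup>2 * u\<^sup>2 / 2))) \<partial>lborel)"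
    by (rule integral_norm_bound)
  also have "\<dots> = (\<integral>u. sqrt (pi / 2) * exp (- ((1 + b\<^sup>2) / 2) * u\<^sup>2) \<partial>lborel)"
    by (intro Bochner_Integration.integral_cong refl)
       (auto simp: norm_mult exp_add[symmetric] field_simps)
  also have "\<dots> = sqrt (pi / 2) * sqrt (pi / ((1 + b\<^sup>2) / 2))"
    using gauss_integral[of "(1 + b\<^sup>2) / 2"] by (simp add: add_pos_nonneg)
  also have "\<dots> = pi / sqrt (1 + b\<^sup>2)"
    by (simp add: real_sqrt_divide real_sqrt_mult)
  finally show ?thesis unfolding I_def f_def[abs_def] .
qed

section \<open>Gaussians and chirps in several variables\<close>

lemma integral_lborel_prod:
  fixes f :: "'a::euclidean_space \<Rightarrow> real \<Rightarrow> complex"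
  assumes "\<And>b. b \<in> Basis \<Longrightarrow> integrable lborel (f b)"
  shows "(\<integral>x. (\<Prod>b\<in>Basis. f b (x \<bullet> b)) \<partial>lborel) = (\<Prod>b\<in>Basis. \<integral>x. f b x \<partial>lborel)"
proof -
  interpret product_sigma_finite "\<lambda>_::'a. lborel :: real measure" ..
  have [measurable]: "f b \<in> borel_measurable borel" if "b \<in> Basis" for b
    using borel_measurable_integrable[OF assms[OF that]] by simp
  have "(\<integral>x. (\<Prod>b\<in>Basis. f b (x \<bullet> b)) \<partial>lborel)
     = (\<integral>x. (\<Prod>b\<in>Basis. f b ((\<Sum>b\<in>Basis. x b *\<^sub>R b) \<bullet> b)) \<partial>(\<Pi>\<^sub>M b\<in>(Basis::'a set). lborel))"
    by (subst lborel_eq, subst integral_distr) auto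
  also have "\<dots> = (\<integral>x. (\<Prod>b\<in>Basis. f b (x b)) \<partial>(\<Pi>\<^sub>M b\<in>(Basis::'a set). lborel))"
    by (intro Bochner_Integration.integral_cong refl prod.cong) simp
  also have "\<dots> = (\<Prod>b\<in>Basis. \<integral>x. f b x \<partial>lborel)"
    by (rule product_integral_prod) (auto intro: assms)
  finally show ?thesis .
qed

lemma gauss_integrable_euclidean:
  fixes c :: real
  assumes "c > 0"
  shows "integrable lborel (\<lambda>w::'a::euclidean_space. exp (- c * (norm w)\<^sup>2))"
proof (rule integrableI_nonneg)
  have "(\<integral>\<^sup>+w. ennreal (exp (- c * w\<^sup>2)) \<partial>lborel) < \<infinity>"
    using gauss_integrable[OF assms] by (simp add: integrable_iff_bounded)
  then have "(\<Prod>b\<in>(Basis::'a set). \<integral>\<^sup>+w. ennreal (exp (- c * w\<^sup>2)) \<partial>lborel) < \<infinity>"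
    by (simp add: power_less_top_ennreal)
  also have "(\<Prod>b\<in>(Basis::'a set). \<integral>\<^sup>+w. ennreal (exp (- c * w\<^sup>2)) \<partial>lborel)
     = (\<integral>\<^sup>+w. (\<Prod>b\<in>(Basis::'a set). ennreal (exp (- c * (w \<bullet> b)\<^sup>2))) \<partial>lborel)"
    by (subst nn_integral_lborel_prod) auto
  also have "\<dots> = (\<integral>\<^sup>+w. ennreal (exp (- c * (norm (w::'a))\<^sup>2)) \<partial>lborel)"
    by (intro nn_integral_cong)
       (simp add: prod_ennreal exp_sum[symmetric] sum_distrib_left sum_negf norm_square_eq_sum_Basis)
  finally show "(\<integral>\<^sup>+w. ennreal (exp (- c * (norm (w::'a))\<^sup>2)) \<partial>lborel) < \<infinity>" .
qed auto

text \<open>Cutoff and phase both factor over the coordinates, and each one-dimensional chirp is at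
  most sqrt pi / (1 + b^2) powr (1/4). Two coordinates already produce the stated decay; any surplus
  from further ones is discarded, so that the bound has the same form in all dimensions.\<close>

lemma chirp_bound_euclidean:
  fixes y :: "'a::euclidean_space"
  assumes "DIM('a) \<ge> 2"
  shows "norm (\<integral>w. exp (- (norm w)\<^sup>2) * cis (y \<bullet> w + b * (norm w)\<^sup>2) \<partial>lborel)
     \<le> sqrt pi ^ DIM('a) / sqrt (1 + b\<^sup>2)"
proof -
  define g where "g k = norm (\<integral>w. exp (- (w::real)\<^sup>2) * cis (k * w + b * w\<^sup>2) \<partial>lborel)" for k
  define D where "D = sqrt (1 + b\<^sup>2)"
  have D: "D \<ge> 1" by (simp add: D_def)
  have split: "exp (- (norm w)\<^sup>2) * cis (y \<bullet> w + b * (norm w)\<^sup>2)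
      = (\<Prod>i\<in>Basis. exp (- (w \<bullet> i)\<^sup>2) * cis ((y \<bullet> i) * (w \<bullet> i) + b * (w \<bullet> i)\<^sup>2))" for w :: 'a
  proof -
    have cis_sum: "cis (sum h A) = (\<Prod>i\<in>A. cis (h i))" if "finite A" for h and A :: "'a set"
      using that by (induction A rule: finite_induct) (auto simp: cis_mult[symmetric])
    show ?thesis
      unfolding norm_square_eq_sum_Basis euclidean_inner[of y w]
      by (simp add: sum_distrib_left sum.distrib[symmetric] cis_sum exp_sum sum_negf[symmetric] prod.distrib)
  qed
  have "norm (\<integral>w. exp (- (norm w)\<^sup>2) * cis (y \<bullet> w + b * (norm w)\<^sup>2) \<partial>lborel) = (\<Prod>i\<in>Basis. g (y \<bullet> i))"
    unfolding split by (subst integral_lborel_prod) (auto simp: chirp_integrable prod_norm g_def)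
  also have "\<dots> \<le> (\<Prod>i\<in>(Basis::'a set). sqrt pi / sqrt D)"
  proof (intro prod_mono conjI)
    fix i
    have "(g (y \<bullet> i))\<^sup>2 \<le> pi / D" using chirp_bound by (simp add: g_def D_def)
    then show "g (y \<bullet> i) \<le> sqrt pi / sqrt D"
      by (metis real_le_rsqrt real_sqrt_divide)
  qed (simp add: g_def)
  also have "\<dots> = sqrt pi ^ DIM('a) / sqrt D ^ DIM('a)" by (simp add: power_divide)
  also have "\<dots> \<le> sqrt pi ^ DIM('a) / sqrt D ^ 2"
    using D assms by (intro divide_left_mono power_increasing) auto
  also have "sqrt D ^ 2 = D" using D by simp
  finally show ?thesis by (simp add: D_def)
qed

section \<open>Oscillatory integrals in one variable\<close>

text \<open>The form in which integration by parts is used on the whole line: \<open>H\<close>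
  collects the boundary terms, which vanish at both ends.\<close>

lemma integral_derivative_eq_0:
  fixes H h :: "real \<Rightarrow> complex"
  assumes "\<And>x. (H has_vector_derivative h x) (at x)" "\<And>x. isCont h x" "integrable lborel h"
    "(H \<longlongrightarrow> 0) at_top" "(H \<longlongrightarrow> 0) at_bot"
  shows "integral\<^sup>L lborel h = 0"
proof -
  have "(LBINT x=-\<infinity>..\<infinity>. h x) = 0 - 0"
    using assms by (intro interval_integral_FTC_integrable[where F = H])
      (auto simp: ereal_tendsto_simps set_integrable_def)
  then show ?thesis
    by (simp add: interval_lebesgue_integral_def set_lebesgue_integral_def)
qed

text \<open>Half of the exponential absorbs the quadratic factor. With u = \<xi>^2 + r that factor
  is the squared growth of the phase derivative, and a Gaussian in all frequency variables is left
  over for the remaining integrations.\<close>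

lemma exp_half_bound:
  fixes u :: real assumes "u \<ge> 0" shows "(1 + u)\<^sup>2 * exp (- u) \<le> 16 * exp (- (1/2) * u)"
proof -
  have "(1 + u) \<le> 4 * exp (u / 4)" using exp_ge_add_one_self[of "u/4"] by linarith
  then have "(1 + u)\<^sup>2 \<le> (4 * exp (u / 4))\<^sup>2" using assms by (intro power_mono) auto
  also have "\<dots> = 16 * exp (u / 2)" by (simp add: power_mult_distrib exp_double[symmetric])
  finally have "(1 + u)\<^sup>2 * exp (- u) \<le> 16 * exp (u / 2) * exp (- u)" by (intro mult_right_mono) auto
  also have "16 * exp (u / 2) * exp (- u) = 16 * exp (u / 2 + - u)" by (simp only: exp_add mult.assoc)
  also have "u / 2 + - u = - (1/2) * u" by simp
  finally show ?thesis .
qed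

text \<open>
  Two integrations by parts in \<open>\<xi>\<close> against \<open>cis (x * \<xi>)\<close>, done in one step: if
  \<open>e' = (q + \<i>x) e\<close>, then \<open>((q - \<i>x) e)' = (q' + q\<^sup>2 + x\<^sup>2) e\<close>.
\<close>

lemma oscillation_bound:
  fixes x t r :: real
  assumes r: "r \<ge> 0"
  shows "x\<^sup>2 * norm (\<integral>\<xi>. of_real (exp (- (\<xi>\<^sup>2 + r))) * cis (x * \<xi> + t * \<xi> * (\<xi>\<^sup>2 + r)) \<partial>lborel)
     \<le> 192 * (1 + \<bar>t\<bar>)\<^sup>2 * (\<integral>\<xi>. exp (- (1/2) * (\<xi>\<^sup>2 + r)) \<partial>lborel)"
proof -
  define e where "e \<xi> = of_real (exp (- (\<xi>\<^sup>2 + r))) * cis (x * \<xi> + t * \<xi> * (\<xi>\<^sup>2 + r))" for \<xi> :: real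
  \<comment> \<open>The logarithmic derivative of \<open>e\<close> with the part
    \<open>\<i> * x\<close> removed: the real part comes from the Gaussian, the imaginary part from
    the phase in t.\<close>
  define q where "q \<xi> = Complex (- 2 * \<xi>) (t * (3 * \<xi>\<^sup>2 + r))" for \<xi> :: real
  define q' where "q' \<xi> = Complex (- 2) (6 * t * \<xi>)" for \<xi> :: real
  have ne: "norm (e \<xi>) = exp (- (\<xi>\<^sup>2 + r))" for \<xi> by (simp add: e_def norm_mult)
  have ce: "continuous_on UNIV e" unfolding e_def by (intro continuous_intros)
  have cq: "continuous_on UNIV q" "continuous_on UNIV q'"
    unfolding q_def q'_def by (intro continuous_intros)+
  have [measurable]: "e \<in> borel_measurable borel" "q \<in> borel_measurable borel" "q' \<in> borel_measurable borel"
    using ce cq by (auto intro: borel_measurable_continuous_onI)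
  have de: "(e has_vector_derivative ((q \<xi> + \<i> * x) * e \<xi>)) (at \<xi>)" for \<xi>
  proof -
    \<comment> \<open>The exponent is extended to a complex polynomial, so that the derivative along
      the real line follows from the complex one.\<close>
    define E where "E z = exp (- (z\<^sup>2 + of_real r) + \<i> * (of_real x * z + of_real t * z * (z\<^sup>2 + of_real r)))" for z :: complex
    have "((\<lambda>\<xi>. E (of_real \<xi>)) has_vector_derivative ((q \<xi> + \<i> * x) * E (of_real \<xi>))) (at \<xi>)"
      unfolding E_def
      by (rule has_vector_derivative_real_field)
         (auto intro!: derivative_eq_intros simp: q_def Complex_eq power2_eq_square algebra_simps)
    moreover have "E (of_real \<xi>) = e \<xi>" for \<xi>
      by (simp add: E_def e_def cis_conv_exp exp_add exp_of_real[symmetric])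
    ultimately show ?thesis by simp
  qed
  have dq: "(q has_vector_derivative q' \<xi>) (at \<xi>)" for \<xi>
  proof -
    define Q where "Q z = - 2 * z + \<i> * of_real t * (3 * z\<^sup>2 + of_real r)" for z :: complex
    have "((\<lambda>\<xi>. Q (of_real \<xi>)) has_vector_derivative q' \<xi>) (at \<xi>)"
      unfolding Q_def
      by (rule has_vector_derivative_real_field)
         (auto intro!: derivative_eq_intros simp: q'_def Complex_eq)
    moreover have "Q (of_real \<xi>) = q \<xi>" for \<xi>
      by (simp add: Q_def q_def Complex_eq)
    ultimately show ?thesis by simp
  qed
  have nq: "norm (q \<xi>) \<le> 3 * (1 + \<bar>t\<bar>) * (1 + \<xi>\<^sup>2 + r)" for \<xi>
  proof -
    have "0 \<le> (1 - \<bar>\<xi>\<bar>)\<^sup>2" by simp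
    then have a: "2 * \<bar>\<xi>\<bar> \<le> 1 + \<xi>\<^sup>2" by (simp add: power2_eq_square algebra_simps)
    have "norm (q \<xi>) \<le> \<bar>2 * \<xi>\<bar> + \<bar>t * (3 * \<xi>\<^sup>2 + r)\<bar>"
      unfolding q_def using cmod_le[of "Complex (- 2 * \<xi>) (t * (3 * \<xi>\<^sup>2 + r))"] by simp
    also have "\<dots> \<le> 1 * (3 * (1 + \<xi>\<^sup>2 + r)) + \<bar>t\<bar> * (3 * (1 + \<xi>\<^sup>2 + r))"
      using a r by (intro add_mono) (auto simp: abs_mult intro!: mult_left_mono)
    finally show ?thesis by (simp add: algebra_simps)
  qed
  have nq': "norm (q' \<xi>) \<le> 3 * (1 + \<bar>t\<bar>) * (1 + \<xi>\<^sup>2 + r)" for \<xi>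
  proof -
    have "0 \<le> (1 - \<bar>\<xi>\<bar>)\<^sup>2" by simp
    then have a: "2 * \<bar>\<xi>\<bar> \<le> 1 + \<xi>\<^sup>2" by (simp add: power2_eq_square algebra_simps)
    have "norm (q' \<xi>) \<le> 2 + \<bar>t\<bar> * (6 * \<bar>\<xi>\<bar>)"
      unfolding q'_def using cmod_le[of "Complex (- 2) (6 * t * \<xi>)"] by (simp add: abs_mult)
    also have "\<dots> \<le> 1 * (3 * (1 + \<xi>\<^sup>2 + r)) + \<bar>t\<bar> * (3 * (1 + \<xi>\<^sup>2 + r))"
      using a r by (intro add_mono mult_left_mono) auto
    finally show ?thesis by (simp add: algebra_simps)
  qed
  have bnd: "norm ((q' \<xi> + (q \<xi>)\<^sup>2) * e \<xi>) \<le> 192 * (1 + \<bar>t\<bar>)\<^sup>2 * exp (- (1/2) * (\<xi>\<^sup>2 + r))" for \<xi>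
  proof -
    \<comment> \<open>Because A B \<ge> 1, the sum 3 A B + 9 (A B)^2 is at most 12 (A B)^2;
      \<open>exp_half_bound\<close> contributes 16, and 12 * 16 = 192.\<close>
    define A where "A = 1 + \<bar>t\<bar>"
    define B where "B = 1 + \<xi>\<^sup>2 + r"
    have AB: "A \<ge> 1" "B \<ge> 1" using r by (auto simp: A_def B_def)
    have "A * B \<ge> 1" using AB mult_mono[of 1 A 1 B] by simp
    then have AB2: "A * B \<le> A\<^sup>2 * B\<^sup>2"
      by (metis mult.right_neutral mult_left_mono order_trans power2_eq_square power_mult_distrib zero_le_one)
    have "norm (q' \<xi> + (q \<xi>)\<^sup>2) \<le> norm (q' \<xi>) + (norm (q \<xi>))\<^sup>2"
      by (metis norm_triangle_ineq norm_power)
    also have "\<dots> \<le> 3 * A * B + (3 * A * B)\<^sup>2"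
      using nq[of \<xi>] nq'[of \<xi>] by (intro add_mono power_mono) (auto simp: A_def B_def)
    also have "\<dots> \<le> 12 * A\<^sup>2 * B\<^sup>2" using AB2 by (simp add: power_mult_distrib)
    finally have "norm ((q' \<xi> + (q \<xi>)\<^sup>2) * e \<xi>) \<le> 12 * A\<^sup>2 * B\<^sup>2 * exp (- (\<xi>\<^sup>2 + r))"
      unfolding norm_mult ne by (intro mult_right_mono) auto
    also have "\<dots> \<le> 12 * A\<^sup>2 * (16 * exp (- (1/2) * (\<xi>\<^sup>2 + r)))"
      using mult_left_mono[OF exp_half_bound[of "\<xi>\<^sup>2 + r"], of "12 * A\<^sup>2"] r
      by (simp only: B_def add.assoc mult.assoc) simp
    finally show ?thesis by (simp add: A_def)
  qed
  have gi: "integrable lborel (\<lambda>\<xi>. exp (- (1/2) * (\<xi>\<^sup>2 + r)))"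
    using integrable_mult_left[OF gauss_integrable[of "1/2"], of "exp (- r / 2)"]
    by (simp add: exp_add[symmetric] add_divide_distrib)
  have ie: "integrable lborel e"
  proof (rule Bochner_Integration.integrable_bound[OF gi])
    have "- (\<xi>\<^sup>2 + r) \<le> - (1/2) * (\<xi>\<^sup>2 + r)" for \<xi> :: real
      using r by (auto simp: field_simps intro: order_trans[of _ 0])
    then show "AE \<xi> in lborel. norm (e \<xi>) \<le> norm (exp (- (1/2) * (\<xi>\<^sup>2 + r)))"
      by (simp only: ne norm_exp real_norm_def abs_exp_cancel exp_le_cancel_iff) simp
  qed simp
  have iq: "integrable lborel (\<lambda>\<xi>. (q' \<xi> + (q \<xi>)\<^sup>2) * e \<xi>)"
    by (rule Bochner_Integration.integrable_bound[OF integrable_mult_right[OF gi, of "192 * (1 + \<bar>t\<bar>)\<^sup>2"]])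
       (use bnd in \<open>auto intro: order_trans\<close>)
  define H where "H \<xi> = (q \<xi> - \<i> * x) * e \<xi>" for \<xi>
  define h where "h \<xi> = (q' \<xi> + (q \<xi>)\<^sup>2) * e \<xi> + of_real (x\<^sup>2) * e \<xi>" for \<xi>
  have nH: "norm (H \<xi>) \<le> (3 * (1 + \<bar>t\<bar>) * (1 + \<xi>\<^sup>2 + r) + \<bar>x\<bar>) * exp (- (\<xi>\<^sup>2 + r))" for \<xi>
  proof -
    have "norm (q \<xi> - \<i> * x) \<le> norm (q \<xi>) + norm (\<i> * complex_of_real x)" by (rule norm_triangle_ineq4)
    also have "\<dots> \<le> 3 * (1 + \<bar>t\<bar>) * (1 + \<xi>\<^sup>2 + r) + \<bar>x\<bar>" using nq[of \<xi>] by (simp add: norm_mult)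
    finally show ?thesis unfolding H_def norm_mult ne by (intro mult_right_mono) auto
  qed
  have "integral\<^sup>L lborel h = 0"
  proof (rule integral_derivative_eq_0[where H = H])
    show "(H has_vector_derivative h \<xi>) (at \<xi>)" for \<xi>
      unfolding H_def h_def
      by (rule derivative_eq_intros dq de refl)+ (simp add: algebra_simps power2_eq_square)
    show "isCont h \<xi>" for \<xi>
      using ce cq unfolding h_def
      by (intro continuous_intros) (auto simp: continuous_on_eq_continuous_at)
    show "integrable lborel h" unfolding h_def using iq ie by simp
    show "(H \<longlongrightarrow> 0) at_top"
      by (rule Lim_null_comparison[OF always_eventually[OF allI[OF nH]]]) real_asymp
    show "(H \<longlongrightarrow> 0) at_bot"
      by (rule Lim_null_comparison[OF always_eventually[OF allI[OF nH]]]) real_asymp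
  qed
  then have "(\<integral>\<xi>. (q' \<xi> + (q \<xi>)\<^sup>2) * e \<xi> \<partial>lborel) + of_real (x\<^sup>2) * integral\<^sup>L lborel e = 0"
    unfolding h_def using iq ie by simp
  then have "of_real (x\<^sup>2) * integral\<^sup>L lborel e = - (\<integral>\<xi>. (q' \<xi> + (q \<xi>)\<^sup>2) * e \<xi> \<partial>lborel)"
    by (simp add: eq_neg_iff_add_eq_0 add.commute)
  then have "norm (of_real (x\<^sup>2) * integral\<^sup>L lborel e) = norm (\<integral>\<xi>. (q' \<xi> + (q \<xi>)\<^sup>2) * e \<xi> \<partial>lborel)"
    by (metis norm_minus_cancel)
  then have "x\<^sup>2 * norm (integral\<^sup>L lborel e) = norm (\<integral>\<xi>. (q' \<xi> + (q \<xi>)\<^sup>2) * e \<xi> \<partial>lborel)"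
    by (simp add: norm_mult norm_power)
  also have "\<dots> \<le> (\<integral>\<xi>. 192 * (1 + \<bar>t\<bar>)\<^sup>2 * exp (- (1/2) * (\<xi>\<^sup>2 + r)) \<partial>lborel)"
    using iq gi bnd by (intro order_trans[OF integral_norm_bound integral_mono]) auto
  finally show ?thesis unfolding e_def[abs_def] by simp
qed

section \<open>Even integrands and singular powers against a Gaussian\<close>

lemma nn_integral_even:
  fixes f :: "real \<Rightarrow> ennreal"
  assumes [measurable]: "f \<in> borel_measurable borel"
  shows "(\<integral>\<^sup>+x. f \<bar>x\<bar> \<partial>lborel) = 2 * (\<integral>\<^sup>+x. f x * indicator {0..} x \<partial>lborel)"
proof -
  have "(\<integral>\<^sup>+x. f \<bar>x\<bar> \<partial>lborel) = (\<integral>\<^sup>+x. f x * indicator {0..} x + f (- x) * indicator {0..} (- x) \<partial>lborel)"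
  proof (rule nn_integral_cong_AE)
    \<comment> \<open>Both indicators contain 0, so the right-hand side counts that point twice; it
      is a null set.\<close>
    have "AE x in lborel. x \<noteq> (0::real)" by (rule AE_lborel_singleton)
    then show "AE x in lborel. f \<bar>x\<bar> = f x * indicator {0..} x + f (- x) * indicator {0..} (- x)"
      by eventually_elim (auto simp: indicator_def)
  qed
  also have "\<dots> = (\<integral>\<^sup>+x. f x * indicator {0..} x \<partial>lborel) + (\<integral>\<^sup>+x. f (- x) * indicator {0..} (- x) \<partial>lborel)"
    by (rule nn_integral_add) auto
  also have "(\<integral>\<^sup>+x. f (- x) * indicator {0..} (- x) \<partial>lborel) = (\<integral>\<^sup>+x. f x * indicator {0..} x \<partial>lborel)"
    using nn_integral_real_affine[of "\<lambda>x. f x * indicator {0..} x" "-1" 0] by simp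
  finally show ?thesis by (simp add: mult_2)
qed

text \<open>Near 0 the power is integrable because a > -1; beyond 1 it is at most 1 because a \<le>
  0, and the Gaussian takes over.\<close>

lemma integrable_powr_gauss:
  fixes a :: real assumes a: "-1 < a" "a \<le> 0"
  shows "integrable lborel (\<lambda>x::real. \<bar>x\<bar> powr a * exp (- x\<^sup>2))"
proof (rule integrableI_nonneg)
  let ?f = "\<lambda>x. ennreal (x powr a * exp (- x\<^sup>2))"
  have "(\<integral>\<^sup>+x. ?f x * indicator {0..} x \<partial>lborel)
     \<le> (\<integral>\<^sup>+x. ennreal (x powr a) * indicator {0..1} x + ennreal (exp (- x\<^sup>2)) \<partial>lborel)"
  proof (rule nn_integral_mono)
    fix x :: real
    consider "x < 0" | "0 \<le> x" "x \<le> 1" | "1 < x" by linarith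
    then show "?f x * indicator {0..} x \<le> ennreal (x powr a) * indicator {0..1} x + ennreal (exp (- x\<^sup>2))"
    proof cases
      case 2
      then have "x powr a * exp (- x\<^sup>2) \<le> x powr a * 1" by (intro mult_left_mono) auto
      then show ?thesis using 2 by (auto intro!: add_increasing2 ennreal_leI)
    next
      case 3
      then have "x powr a \<le> 1" using a powr_mono[of a 0 x] by simp
      then have "x powr a * exp (- x\<^sup>2) \<le> 1 * exp (- x\<^sup>2)" by (intro mult_right_mono) auto
      then show ?thesis using 3 by (auto intro!: ennreal_leI)
    qed auto
  qed
  also have "\<dots> = (\<integral>\<^sup>+x. ennreal (x powr a) * indicator {0..1} x \<partial>lborel) + (\<integral>\<^sup>+x. ennreal (exp (- x\<^sup>2)) \<partial>lborel)"
    by (rule nn_integral_add) auto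
  also have "\<dots> < \<infinity>"
  proof -
    have "(\<integral>\<^sup>+x. ennreal (x powr a) * indicator {0..1} x \<partial>lborel) = ennreal (1 powr (a + 1) / (a + 1))"
      using nn_integral_has_integral_lebesgue[OF _ has_integral_powr_from_0[of a 1]] a
      by (simp add: mult.commute ennreal_mult'' ennreal_indicator)
    moreover have "(\<integral>\<^sup>+x. ennreal (exp (- (x::real)\<^sup>2)) \<partial>lborel) < \<infinity>"
      using gauss_integrable[of 1] by (simp add: integrable_iff_bounded)
    ultimately show ?thesis by simp
  qed
  finally have "2 * (\<integral>\<^sup>+x. ?f x * indicator {0..} x \<partial>lborel) < \<infinity>"
    by (simp add: ennreal_mult_less_top)
  also have "2 * (\<integral>\<^sup>+x. ?f x * indicator {0..} x \<partial>lborel) = (\<integral>\<^sup>+x. ?f \<bar>x\<bar> \<partial>lborel)"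
    by (rule nn_integral_even[symmetric]) measurable
  finally show "(\<integral>\<^sup>+x. ennreal (\<bar>x\<bar> powr a * exp (- x\<^sup>2)) \<partial>lborel) < \<infinity>" by simp
qed auto

section \<open>The frequency-localised kernel\<close>

text \<open>The prefix stands for Zakharov-Kuznetsov, the equation whose linear part generates
  \<open>U\<close>. The phase is linear in (x, y, t), so a difference of two phases is the phase at
  the difference; and y and t are separate arguments because they later become functions of
  x.\<close>

definition zk_phase :: "real \<Rightarrow> 'b::euclidean_space \<Rightarrow> real \<Rightarrow> real \<times> 'b \<Rightarrow> real" where
  "zk_phase x y t \<zeta> = x * fst \<zeta> + y \<bullet> snd \<zeta> + t * fst \<zeta> * (norm \<zeta>)\<^sup>2"

text \<open>Up to normalisation, the solution at (x, y) and time t whose initial datum has the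
  Gaussian \<open>exp (- \<tau> * (norm \<zeta>)^2)\<close> as its Fourier transform.\<close>

definition zk_kernel :: "real \<Rightarrow> real \<Rightarrow> 'b::euclidean_space \<Rightarrow> real \<Rightarrow> complex" where
  "zk_kernel \<tau> x y t = (\<integral>\<zeta>. of_real (exp (- \<tau> * (norm \<zeta>)\<^sup>2)) * cis (zk_phase x y t \<zeta>) \<partial>lborel)"

lemma norm_square_prod: "(norm (\<zeta>::real \<times> 'b::euclidean_space))\<^sup>2 = (fst \<zeta>)\<^sup>2 + (norm (snd \<zeta>))\<^sup>2"
  by (simp add: norm_prod_def)

lemma zk_phase_Pair:
  "zk_phase x y t (\<xi>, \<eta>) = x * \<xi> + y \<bullet> \<eta> + t * \<xi> * (\<xi>\<^sup>2 + (norm \<eta>)\<^sup>2)"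
  by (simp add: zk_phase_def norm_square_prod)

lemma measurable_cis[measurable]: "cis \<in> borel_measurable borel"
  by (intro borel_measurable_continuous_onI continuous_intros)

lemma measurable_fst_snd_borel[measurable]:
  "(fst :: 'a::topological_space \<times> 'b::topological_space \<Rightarrow> 'a) \<in> borel_measurable borel"
  "(snd :: 'a \<times> 'b \<Rightarrow> 'b) \<in> borel_measurable borel"
  by (auto intro!: borel_measurable_continuous_onI
      continuous_on_fst[OF continuous_on_id] continuous_on_snd[OF continuous_on_id])

lemma measurable_zk_phase[measurable (raw)]:
  fixes Y :: "'c \<Rightarrow> 'a::euclidean_space"
  assumes [measurable]: "X \<in> borel_measurable M" "Y \<in> borel_measurable M" "T \<in> borel_measurable M"
    "Z \<in> M \<rightarrow>\<^sub>M borel"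
  shows "(\<lambda>w. zk_phase (X w) (Y w) (T w) (Z w)) \<in> borel_measurable M"
  unfolding zk_phase_def by measurable

lemma zk_integrand_integrable:
  assumes "\<tau> > 0"
  shows "integrable lborel (\<lambda>\<zeta>::real \<times> 'b::euclidean_space. of_real (exp (- \<tau> * (norm \<zeta>)\<^sup>2)) * cis (zk_phase x y t \<zeta>))"
  by (rule Bochner_Integration.integrable_bound[OF gauss_integrable_euclidean[OF assms]]) (auto simp: norm_mult)

lemma measurable_zk_kernel[measurable (raw)]:
  fixes Y :: "'c \<Rightarrow> 'a::euclidean_space"
  assumes [measurable]: "X \<in> borel_measurable M" "Y \<in> borel_measurable M" "T \<in> borel_measurable M"
  shows "(\<lambda>w. zk_kernel \<tau> (X w) (Y w) (T w)) \<in> borel_measurable M"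
  unfolding zk_kernel_def by measurable

lemma norm_zk_kernel_le:
  assumes "\<tau> > 0"
  shows "norm (zk_kernel \<tau> x (y::'b::euclidean_space) t) \<le> (\<integral>\<zeta>. exp (- \<tau> * (norm (\<zeta>::real \<times> 'b))\<^sup>2) \<partial>lborel)"
  unfolding zk_kernel_def by (rule order_trans[OF integral_norm_bound]) (simp add: norm_mult)

lemma zk_kernel_integrable_pair:
  fixes y :: "'b::euclidean_space"
  shows "integrable (lborel \<Otimes>\<^sub>M lborel) (\<lambda>(\<xi>, \<eta>). of_real (exp (- (\<xi>\<^sup>2 + (norm \<eta>)\<^sup>2))) * cis (zk_phase x y t (\<xi>, \<eta>)))"
  using zk_integrand_integrable[of 1 x y t] unfolding lborel_prod
  by (simp add: norm_square_prod case_prod_beta')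

lemma zk_kernel_one_pair:
  fixes y :: "'b::euclidean_space"
  shows "zk_kernel 1 x y t =
    (\<integral>z. (\<lambda>(\<xi>, \<eta>). of_real (exp (- (\<xi>\<^sup>2 + (norm \<eta>)\<^sup>2))) * cis (zk_phase x y t (\<xi>, \<eta>))) z \<partial>(lborel \<Otimes>\<^sub>M lborel))"
  unfolding zk_kernel_def lborel_prod
  by (rule Bochner_Integration.integral_cong) (auto simp: norm_square_prod)

lemma sqrt_one_plus_ge_powr:
  fixes a \<theta> :: real assumes "0 \<le> \<theta>" "\<theta> \<le> 1"
  shows "\<bar>a\<bar> powr \<theta> \<le> sqrt (1 + a\<^sup>2)"
proof (cases "\<bar>a\<bar> \<le> 1")
  case True
  then have "\<bar>a\<bar> powr \<theta> \<le> 1" using assms powr_mono2[of \<theta> "\<bar>a\<bar>" 1] by simp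
  also have "1 \<le> sqrt (1 + a\<^sup>2)" by simp
  finally show ?thesis .
next
  case False
  then have "\<bar>a\<bar> powr \<theta> \<le> \<bar>a\<bar> powr 1" using assms by (intro powr_mono) auto
  also have "\<dots> = sqrt (a\<^sup>2)" by simp
  also have "\<dots> \<le> sqrt (1 + a\<^sup>2)" by (intro real_sqrt_le_mono) simp
  finally show ?thesis .
qed

text \<open>For fixed \<xi> \<noteq> 0 the \<eta>-integral is a chirp with parameter b = t \<xi>.
  Its full decay |t \<xi>| powr -1 is not integrable at \<xi> = 0, so only the power \<theta> < 1 is
  kept; it splits into |t| powr -\<theta> and an integrable function of \<xi>. Oscillation in \<xi>
  is not exploited, which is why x does not appear.\<close>

lemma zk_kernel_dispersive:
  assumes dim: "DIM('b::euclidean_space) \<ge> 2" and \<theta>: "0 \<le> \<theta>" "\<theta> < 1"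
  obtains A where "A \<ge> 0" "\<And>x (y::'b) t. t \<noteq> 0 \<Longrightarrow> norm (zk_kernel 1 x y t) \<le> A * \<bar>t\<bar> powr (- \<theta>)"
proof
  define J where "J = (\<integral>\<xi>. \<bar>\<xi>\<bar> powr (- \<theta>) * exp (- (\<xi>::real)\<^sup>2) \<partial>lborel)"
  show "sqrt pi ^ DIM('b) * J \<ge> 0" unfolding J_def by (intro mult_nonneg_nonneg integral_nonneg_AE) auto
  fix x t :: real and y :: 'b assume t: "t \<noteq> 0"
  let ?f = "\<lambda>\<xi> (\<eta>::'b). of_real (exp (- (\<xi>\<^sup>2 + (norm \<eta>)\<^sup>2))) * cis (zk_phase x y t (\<xi>, \<eta>))"
  have int: "integrable lborel (\<lambda>\<xi>. \<integral>\<eta>. ?f \<xi> \<eta> \<partial>lborel)"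
    using lborel_pair.integrable_fst[OF zk_kernel_integrable_pair[of x y t]] by simp
  have inner: "norm (\<integral>\<eta>. ?f \<xi> \<eta> \<partial>lborel) \<le> sqrt pi ^ DIM('b) * \<bar>t\<bar> powr (- \<theta>) * (\<bar>\<xi>\<bar> powr (- \<theta>) * exp (- \<xi>\<^sup>2))"
    if \<xi>: "\<xi> \<noteq> 0" for \<xi>
  proof -
    have "?f \<xi> \<eta> = (of_real (exp (- \<xi>\<^sup>2)) * cis (x * \<xi> + t * \<xi> ^ 3)) *
        (of_real (exp (- (norm \<eta>)\<^sup>2)) * cis (y \<bullet> \<eta> + (t * \<xi>) * (norm \<eta>)\<^sup>2))" for \<eta>
    proof -
      have "zk_phase x y t (\<xi>, \<eta>) = (x * \<xi> + t * \<xi> ^ 3) + (y \<bullet> \<eta> + (t * \<xi>) * (norm \<eta>)\<^sup>2)"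
        by (simp add: zk_phase_Pair algebra_simps power2_eq_square power3_eq_cube)
      moreover have "exp (- (\<xi>\<^sup>2 + (norm \<eta>)\<^sup>2)) = exp (- \<xi>\<^sup>2) * exp (- (norm \<eta>)\<^sup>2)"
        by (simp add: exp_add[symmetric])
      ultimately show ?thesis by (simp add: cis_mult[symmetric] mult_ac)
    qed
    then have "norm (\<integral>\<eta>. ?f \<xi> \<eta> \<partial>lborel) = exp (- \<xi>\<^sup>2) *
        norm (\<integral>\<eta>. of_real (exp (- (norm \<eta>)\<^sup>2)) * cis (y \<bullet> \<eta> + (t * \<xi>) * (norm \<eta>)\<^sup>2) \<partial>lborel)"
      by (simp add: norm_mult)
    also have "\<dots> \<le> exp (- \<xi>\<^sup>2) * (sqrt pi ^ DIM('b) / sqrt (1 + (t * \<xi>)\<^sup>2))"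
      by (intro mult_left_mono chirp_bound_euclidean[OF dim]) auto
    also have "\<dots> \<le> exp (- \<xi>\<^sup>2) * (sqrt pi ^ DIM('b) / \<bar>t * \<xi>\<bar> powr \<theta>)"
      using \<theta> t \<xi> sqrt_one_plus_ge_powr[of \<theta> "t * \<xi>"]
      by (intro mult_left_mono divide_left_mono mult_pos_pos) (auto simp: add_pos_nonneg)
    also have "\<dots> = sqrt pi ^ DIM('b) * \<bar>t\<bar> powr (- \<theta>) * (\<bar>\<xi>\<bar> powr (- \<theta>) * exp (- \<xi>\<^sup>2))"
      by (simp add: abs_mult powr_mult powr_minus field_simps)
    finally show ?thesis .
  qed
  have "norm (zk_kernel 1 x y t) = norm (\<integral>\<xi>. \<integral>\<eta>. ?f \<xi> \<eta> \<partial>lborel \<partial>lborel)"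
    unfolding zk_kernel_one_pair lborel_pair.integral_fst[OF zk_kernel_integrable_pair[of x y t]] by simp
  also have "\<dots> \<le> (\<integral>\<xi>. norm (\<integral>\<eta>. ?f \<xi> \<eta> \<partial>lborel) \<partial>lborel)"
    by (rule integral_norm_bound)
  also have "\<dots> \<le> (\<integral>\<xi>. sqrt pi ^ DIM('b) * \<bar>t\<bar> powr (- \<theta>) * (\<bar>\<xi>\<bar> powr (- \<theta>) * exp (- \<xi>\<^sup>2)) \<partial>lborel)"
  proof (rule integral_mono_AE)
    show "integrable lborel (\<lambda>\<xi>. sqrt pi ^ DIM('b) * \<bar>t\<bar> powr (- \<theta>) * (\<bar>\<xi>\<bar> powr (- \<theta>) * exp (- \<xi>\<^sup>2)))"
      using \<theta> by (intro integrable_mult_right integrable_powr_gauss) auto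
    have "AE \<xi> in lborel. \<xi> \<noteq> (0::real)" by (rule AE_lborel_singleton)
    then show "AE \<xi> in lborel. norm (\<integral>\<eta>. ?f \<xi> \<eta> \<partial>lborel)
        \<le> sqrt pi ^ DIM('b) * \<bar>t\<bar> powr (- \<theta>) * (\<bar>\<xi>\<bar> powr (- \<theta>) * exp (- \<xi>\<^sup>2))"
      by eventually_elim (rule inner)
  qed (use int in auto)
  also have "\<dots> = sqrt pi ^ DIM('b) * J * \<bar>t\<bar> powr (- \<theta>)"
    by (simp add: J_def)
  finally show "norm (zk_kernel 1 x y t) \<le> sqrt pi ^ DIM('b) * J * \<bar>t\<bar> powr (- \<theta>)" .
qed

text \<open>For fixed \<eta> the factor \<open>cis (y \<bullet> \<eta>)\<close> has modulus 1 and
  does not depend on \<xi>, so the bound is uniform in y. The rest is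
  \<open>oscillation_bound\<close> with r = |\<eta>|^2, whose right-hand side still carries a
  Gaussian in \<eta> and can be integrated.\<close>

lemma zk_kernel_nonstationary:
  obtains A where "A \<ge> 0"
    "\<And>x (y::'b::euclidean_space) t. x\<^sup>2 * norm (zk_kernel 1 x y t) \<le> A * (1 + \<bar>t\<bar>)\<^sup>2"
proof
  define J where "J = (\<integral>\<zeta>. exp (- (1/2) * (norm (\<zeta>::real \<times> 'b))\<^sup>2) \<partial>lborel)"
  show "192 * J \<ge> 0" unfolding J_def by (intro mult_nonneg_nonneg integral_nonneg_AE) auto
  fix x t :: real and y :: 'b
  let ?f = "\<lambda>\<xi> (\<eta>::'b). of_real (exp (- (\<xi>\<^sup>2 + (norm \<eta>)\<^sup>2))) * cis (zk_phase x y t (\<xi>, \<eta>))"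
  let ?g = "\<lambda>\<xi> (\<eta>::'b). exp (- (1/2) * (\<xi>\<^sup>2 + (norm \<eta>)\<^sup>2))"
  have int: "integrable lborel (\<lambda>\<eta>. \<integral>\<xi>. ?f \<xi> \<eta> \<partial>lborel)"
    using lborel_pair.integrable_snd[OF zk_kernel_integrable_pair[of x y t]] by simp
  have gint: "integrable (lborel \<Otimes>\<^sub>M lborel) (\<lambda>(\<xi>, \<eta>). ?g \<xi> \<eta>)"
    using gauss_integrable_euclidean[of "1/2", where 'a = "real \<times> 'b"] unfolding lborel_prod
    by (simp add: norm_square_prod case_prod_beta')
  have inner: "x\<^sup>2 * norm (\<integral>\<xi>. ?f \<xi> \<eta> \<partial>lborel) \<le> 192 * (1 + \<bar>t\<bar>)\<^sup>2 * (\<integral>\<xi>. ?g \<xi> \<eta> \<partial>lborel)" for \<eta>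
  proof -
    have "?f \<xi> \<eta> = cis (y \<bullet> \<eta>) *
        (of_real (exp (- (\<xi>\<^sup>2 + (norm \<eta>)\<^sup>2))) * cis (x * \<xi> + t * \<xi> * (\<xi>\<^sup>2 + (norm \<eta>)\<^sup>2)))" for \<xi>
      by (simp add: zk_phase_Pair cis_mult[symmetric] mult_ac)
    then have "norm (\<integral>\<xi>. ?f \<xi> \<eta> \<partial>lborel) =
        norm (\<integral>\<xi>. of_real (exp (- (\<xi>\<^sup>2 + (norm \<eta>)\<^sup>2))) * cis (x * \<xi> + t * \<xi> * (\<xi>\<^sup>2 + (norm \<eta>)\<^sup>2)) \<partial>lborel)"
      by (simp only: integral_mult_right_zero norm_mult norm_cis mult_1)
    then show ?thesis using oscillation_bound[of "(norm \<eta>)\<^sup>2" x t] by simp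
  qed
  have "x\<^sup>2 * norm (zk_kernel 1 x y t) = x\<^sup>2 * norm (\<integral>\<eta>. \<integral>\<xi>. ?f \<xi> \<eta> \<partial>lborel \<partial>lborel)"
    unfolding zk_kernel_one_pair lborel_pair.integral_snd[OF zk_kernel_integrable_pair[of x y t]] by simp
  also have "\<dots> \<le> x\<^sup>2 * (\<integral>\<eta>. norm (\<integral>\<xi>. ?f \<xi> \<eta> \<partial>lborel) \<partial>lborel)"
    by (intro mult_left_mono integral_norm_bound) auto
  also have "\<dots> = (\<integral>\<eta>. x\<^sup>2 * norm (\<integral>\<xi>. ?f \<xi> \<eta> \<partial>lborel) \<partial>lborel)" by simp
  also have "\<dots> \<le> (\<integral>\<eta>. 192 * (1 + \<bar>t\<bar>)\<^sup>2 * (\<integral>\<xi>. ?g \<xi> \<eta> \<partial>lborel) \<partial>lborel)"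
    using int lborel_pair.integrable_snd[OF gint] inner by (intro integral_mono integrable_mult_right) auto
  also have "\<dots> = 192 * (1 + \<bar>t\<bar>)\<^sup>2 * (\<integral>\<eta>. \<integral>\<xi>. ?g \<xi> \<eta> \<partial>lborel \<partial>lborel)" by simp
  also have "(\<integral>\<eta>. \<integral>\<xi>. ?g \<xi> \<eta> \<partial>lborel \<partial>lborel) = J"
    unfolding J_def lborel_pair.integral_snd[OF gint]
    by (simp add: lborel_prod norm_square_prod case_prod_beta')
  finally show "x\<^sup>2 * norm (zk_kernel 1 x y t) \<le> 192 * J * (1 + \<bar>t\<bar>)\<^sup>2" by (simp add: mult_ac)
qed

section \<open>A majorant of the kernel that depends on x alone\<close>

definition zk_majorant :: "real \<Rightarrow> real" where
  "zk_majorant x = (if \<bar>x\<bar> \<le> 1 then 1 else \<bar>x\<bar> powr (- 4/7))"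

lemma measurable_zk_majorant[measurable]: "zk_majorant \<in> borel_measurable borel"
  unfolding zk_majorant_def by measurable

lemma zk_majorant_nonneg: "zk_majorant x \<ge> 0"
  by (simp add: zk_majorant_def)

text \<open>
  The dispersive bound with exponent \<open>4/5\<close> is used for \<open>\<bar>t\<bar> \<ge> \<bar>x\<bar> powr (5/7)\<close> and the
  nonstationary one otherwise; this choice balances the two, and square integrability only
  requires a decay rate above \<open>1/2\<close>.
\<close>

lemma zk_kernel_one_bound:
  assumes dim: "DIM('b::euclidean_space) \<ge> 2"
  obtains A where "A \<ge> 0" "\<And>x (y::'b) t. norm (zk_kernel 1 x y t) \<le> A * zk_majorant x"
proof -
  obtain A1 where A1: "A1 \<ge> 0"
    "\<And>x (y::'b) t. t \<noteq> 0 \<Longrightarrow> norm (zk_kernel 1 x y t) \<le> A1 * \<bar>t\<bar> powr (- 4/5)"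
    using zk_kernel_dispersive[OF dim, of "4/5"] by auto
  obtain A2 where A2: "A2 \<ge> 0"
    "\<And>x (y::'b) t. x\<^sup>2 * norm (zk_kernel 1 x y t) \<le> A2 * (1 + \<bar>t\<bar>)\<^sup>2"
    using zk_kernel_nonstationary by blast
  define A0 where "A0 = (\<integral>\<zeta>. exp (- 1 * (norm (\<zeta>::real \<times> 'b))\<^sup>2) \<partial>lborel)"
  have A0: "A0 \<ge> 0" unfolding A0_def by (intro integral_nonneg_AE) auto
  define A where "A = A0 + A1 + 4 * A2"
  show ?thesis
  proof
    show "A \<ge> 0" using A0 A1 A2 by (simp add: A_def)
    fix x t :: real and y :: 'b
    let ?K = "norm (zk_kernel 1 x y t)"
    \<comment> \<open>On the threshold |t| = |x| powr (5/7) both bounds have the size |x| powr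
      (-4/7), since (4/5)(5/7) = 4/7 and 2 - 2(5/7) = 4/7. For |x| \<le> 1 the absolute bound
      suffices.\<close>
    consider "\<bar>x\<bar> \<le> 1" | "\<bar>x\<bar> > 1" "\<bar>x\<bar> powr (5/7) \<le> \<bar>t\<bar>" | "\<bar>x\<bar> > 1" "\<bar>t\<bar> < \<bar>x\<bar> powr (5/7)"
      by linarith
    then show "?K \<le> A * zk_majorant x"
    proof cases
      case 1
      have "?K \<le> A0" unfolding A0_def by (rule norm_zk_kernel_le) simp
      then show ?thesis using 1 A1 A2 by (simp add: zk_majorant_def A_def)
    next
      case 2
      have "\<bar>x\<bar> powr (5/7) > 0" using 2 by simp
      then have "t \<noteq> 0" using 2 by linarith
      then have "?K \<le> A1 * \<bar>t\<bar> powr (- 4/5)" by (rule A1)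
      also have "\<dots> \<le> A1 * (\<bar>x\<bar> powr (5/7)) powr (- 4/5)"
        using 2 A1 by (intro mult_left_mono powr_mono2') auto
      also have "\<dots> = A1 * \<bar>x\<bar> powr (- 4/7)" by (simp add: powr_powr)
      also have "\<dots> \<le> A * \<bar>x\<bar> powr (- 4/7)"
        using A0 A2 by (intro mult_right_mono) (auto simp: A_def)
      finally show ?thesis using 2 by (simp add: zk_majorant_def)
    next
      case 3
      have "\<bar>x\<bar> powr (5/7) \<ge> 1" using 3 by (intro ge_one_powr_ge_zero) auto
      then have "1 + \<bar>t\<bar> \<le> 2 * \<bar>x\<bar> powr (5/7)" using 3 by linarith
      then have "(1 + \<bar>t\<bar>)\<^sup>2 \<le> (2 * \<bar>x\<bar> powr (5/7))\<^sup>2" by (intro power_mono) auto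
      also have "\<dots> = 4 * \<bar>x\<bar> powr (10/7)"
        using 3 by (simp add: power_mult_distrib powr_power)
      finally have "x\<^sup>2 * ?K \<le> A2 * (4 * \<bar>x\<bar> powr (10/7))"
        using A2(2)[of x y t] A2(1) by (meson mult_left_mono order_trans)
      then have "?K \<le> 4 * A2 * (\<bar>x\<bar> powr (10/7) / x\<^sup>2)"
        using 3 by (simp add: field_simps)
      also have "x\<^sup>2 = \<bar>x\<bar> powr 2" using 3 by simp
      also have "\<bar>x\<bar> powr (10/7) / \<bar>x\<bar> powr 2 = \<bar>x\<bar> powr (- 4/7)"
        unfolding powr_diff[symmetric] by simp
      also have "4 * A2 * \<bar>x\<bar> powr (- 4/7) \<le> A * \<bar>x\<bar> powr (- 4/7)"
        using A0 A1 by (intro mult_right_mono) (auto simp: A_def)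
      finally show ?thesis using 3 by (simp add: zk_majorant_def)
    qed
  qed
qed

lemma zk_majorant_square_integrable: "(\<integral>\<^sup>+x. ennreal ((zk_majorant x)\<^sup>2) \<partial>lborel) < \<infinity>"
proof -
  let ?f = "\<lambda>x. ennreal ((zk_majorant x)\<^sup>2)"
  have "(\<integral>\<^sup>+x. ?f x * indicator {0..} x \<partial>lborel)
      \<le> (\<integral>\<^sup>+x. indicator {0..1} x + ennreal (x powr (- 8/7)) * indicator {1..} x \<partial>lborel)"
    by (intro nn_integral_mono) (auto simp: zk_majorant_def indicator_def powr_power)
  also have "\<dots> = (\<integral>\<^sup>+x. indicator {0..1::real} x \<partial>lborel) + (\<integral>\<^sup>+x. ennreal (x powr (- 8/7)) * indicator {1..} x \<partial>lborel)"
    by (rule nn_integral_add) auto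
  \<comment> \<open>The tail integral is 1 / (8/7 - 1) = 7.\<close>
  also have "(\<integral>\<^sup>+x. ennreal (x powr (- 8/7)) * indicator {1..} x \<partial>lborel) = ennreal 7"
    using nn_integral_has_integral_lebesgue[OF _ has_integral_powr_to_inf[of "- 8/7" 1]]
    by (simp add: mult.commute ennreal_mult'' ennreal_indicator)
  also have "(\<integral>\<^sup>+x. indicator {0..1::real} x \<partial>lborel) + ennreal 7 < \<infinity>" by simp
  finally have "2 * (\<integral>\<^sup>+x. ?f x * indicator {0..} x \<partial>lborel) < \<infinity>"
    by (simp add: ennreal_mult_less_top)
  also have "2 * (\<integral>\<^sup>+x. ?f x * indicator {0..} x \<partial>lborel) = (\<integral>\<^sup>+x. ?f \<bar>x\<bar> \<partial>lborel)"
    by (rule nn_integral_even[symmetric]) measurable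
  also have "(\<lambda>x. ?f \<bar>x\<bar>) = ?f" by (auto simp: zk_majorant_def fun_eq_iff)
  finally show ?thesis .
qed

section \<open>Scaling of the kernel\<close>

lemma integral_scaleR:
  fixes f :: "'a::euclidean_space \<Rightarrow> complex"
  assumes "c > 0" and [measurable]: "f \<in> borel_measurable borel"
  shows "(\<integral>z. f z \<partial>lborel) = of_real (c ^ DIM('a)) * (\<integral>z. f (c *\<^sub>R z) \<partial>lborel)"
  using assms(1)
  by (subst lborel_affine[of c 0])
     (simp_all add: integral_density integral_distr scaleR_conv_of_real)

text \<open>The dispersion symbol is homogeneous of degree 3, so dilating the frequency by c
  multiplies x and y by c and t by c^3; the Jacobian gives the power of c in front. Every cutoff is
  thereby reduced to \<tau> = 1.\<close>

lemma zk_kernel_scale: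
  fixes y :: "'b::euclidean_space"
  assumes "c > 0"
  shows "zk_kernel (1 / c\<^sup>2) x y t = of_real (c ^ (DIM('b) + 1)) * zk_kernel 1 (c * x) (c *\<^sub>R y) (c ^ 3 * t)"
proof -
  have "zk_phase x y t (c *\<^sub>R \<zeta>) = zk_phase (c * x) (c *\<^sub>R y) (c ^ 3 * t) \<zeta>" for \<zeta>
    by (simp add: zk_phase_def power_mult_distrib power2_eq_square power3_eq_cube algebra_simps)
  moreover have "- (1 / c\<^sup>2) * (norm (c *\<^sub>R \<zeta>))\<^sup>2 = - 1 * (norm \<zeta>)\<^sup>2" for \<zeta> :: "real \<times> 'b"
    using assms by (simp add: power_mult_distrib)
  ultimately show ?thesis
    unfolding zk_kernel_def
    by (subst integral_scaleR[OF assms]) (simp_all del: norm_scaleR)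
qed

section \<open>The dual extension operator\<close>

lemma ennreal_power2_le_imp_le:
  fixes x y :: ennreal
  assumes "x\<^sup>2 \<le> y\<^sup>2" shows "x \<le> y"
  using assms
  by (cases x; cases y)
     (auto simp: ennreal_power ennreal_le_iff ennreal_top_eq_mult_iff top_power_ennreal top_unique dest: power2_le_imp_le)

lemma nn_integral_diff_shift:
  fixes g :: "real \<Rightarrow> ennreal"
  assumes [measurable]: "g \<in> borel_measurable borel"
  shows "(\<integral>\<^sup>+y. g (x - y) \<partial>lborel) = (\<integral>\<^sup>+y. g y \<partial>lborel)" "(\<integral>\<^sup>+y. g (y - x) \<partial>lborel) = (\<integral>\<^sup>+y. g y \<partial>lborel)"
  using nn_integral_real_affine[of g "-1" x] nn_integral_real_affine[of g 1 "-x"] by simp_all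

text \<open>A dual form of Young's inequality, from L^(4/3) to L^4 with kernel in L^2, where v is
  the cube root of the modulus of the input. Cauchy-Schwarz is applied to v(x)^2 v(y)^2 times v(x)
  v(y) g(x - y); the square of the second factor is v(x)^2 g times v(y)^2 g, and a second
  application bounds it. Cubes and an outer square keep all exponents integral, so that everything
  stays in \<open>ennreal\<close> and no finiteness has to be assumed.\<close>

lemma nn_integral_young:
  fixes v g :: "real \<Rightarrow> ennreal"
  assumes [measurable]: "v \<in> borel_measurable borel" "g \<in> borel_measurable borel"
  shows "(\<integral>\<^sup>+x. \<integral>\<^sup>+y. v x ^ 3 * v y ^ 3 * g (x - y) \<partial>lborel \<partial>lborel)\<^sup>2
    \<le> (\<integral>\<^sup>+x. v x ^ 4 \<partial>lborel) ^ 3 * (\<integral>\<^sup>+x. (g x)\<^sup>2 \<partial>lborel)"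
proof -
  define P where "P = (\<integral>\<^sup>+x. v x ^ 4 \<partial>lborel)"
  define B where "B = (\<integral>\<^sup>+x. (g x)\<^sup>2 \<partial>lborel)"
  let ?M = "lborel \<Otimes>\<^sub>M lborel :: (real \<times> real) measure"
  let ?S = "\<integral>\<^sup>+z. (v (fst z) * v (snd z) * g (fst z - snd z))\<^sup>2 \<partial>?M"
  have B1: "(\<integral>\<^sup>+z. ((v (fst z))\<^sup>2 * g (fst z - snd z))\<^sup>2 \<partial>?M) = P * B"
    by (subst lborel.nn_integral_fst[symmetric])
       (simp_all add: power_mult_distrib nn_integral_cmult nn_integral_multc nn_integral_diff_shift[of "\<lambda>x. (g x)\<^sup>2"]
          P_def B_def flip: power_mult)
  have B2: "(\<integral>\<^sup>+z. ((v (snd z))\<^sup>2 * g (fst z - snd z))\<^sup>2 \<partial>?M) = P * B"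
    by (subst lborel_pair.nn_integral_snd[symmetric])
       (simp_all add: power_mult_distrib nn_integral_cmult nn_integral_multc nn_integral_diff_shift[of "\<lambda>x. (g x)\<^sup>2"]
          P_def B_def case_prod_beta' flip: power_mult)
  have PP: "(\<integral>\<^sup>+z. ((v (fst z))\<^sup>2 * (v (snd z))\<^sup>2)\<^sup>2 \<partial>?M) = P * P"
    by (subst lborel.nn_integral_fst[symmetric])
       (simp_all add: power_mult_distrib nn_integral_cmult nn_integral_multc P_def flip: power_mult)
  have eq: "?S = (\<integral>\<^sup>+z. ((v (fst z))\<^sup>2 * g (fst z - snd z)) * ((v (snd z))\<^sup>2 * g (fst z - snd z)) \<partial>?M)"
    by (intro nn_integral_cong) (simp add: power2_eq_square mult_ac)
  have "(\<integral>\<^sup>+z. ((v (fst z))\<^sup>2 * g (fst z - snd z)) * ((v (snd z))\<^sup>2 * g (fst z - snd z)) \<partial>?M)\<^sup>2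
      \<le> (\<integral>\<^sup>+z. ((v (fst z))\<^sup>2 * g (fst z - snd z))\<^sup>2 \<partial>?M) * (\<integral>\<^sup>+z. ((v (snd z))\<^sup>2 * g (fst z - snd z))\<^sup>2 \<partial>?M)"
    by (rule Cauchy_Schwarz_nn_integral) measurable
  then have "?S\<^sup>2 \<le> (P * B) * (P * B)"
    unfolding B1 B2 eq[symmetric] .
  then have "?S\<^sup>2 \<le> (P * B)\<^sup>2" by (simp only: power2_eq_square[of "P * B"])
  then have S: "?S \<le> P * B" by (rule ennreal_power2_le_imp_le)
  have "(\<integral>\<^sup>+x. \<integral>\<^sup>+y. v x ^ 3 * v y ^ 3 * g (x - y) \<partial>lborel \<partial>lborel)
     = (\<integral>\<^sup>+z. ((v (fst z))\<^sup>2 * (v (snd z))\<^sup>2) * (v (fst z) * v (snd z) * g (fst z - snd z)) \<partial>?M)"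
    by (subst lborel.nn_integral_fst[symmetric]) (simp_all only: fst_conv snd_conv, simp_all add: power2_eq_square power3_eq_cube mult_ac)
  also have "\<dots>\<^sup>2 \<le> (P * P) * ?S"
    unfolding PP[symmetric] by (rule Cauchy_Schwarz_nn_integral) measurable
  also have "\<dots> \<le> (P * P) * (P * B)" by (intro mult_left_mono S) auto
  finally show ?thesis by (simp add: P_def B_def power3_eq_cube mult_ac)
qed

lemma integral_tensor:
  fixes f :: "'a::euclidean_space \<Rightarrow> complex" and g :: "'b::euclidean_space \<Rightarrow> complex"
  assumes f: "integrable lborel f" and g: "integrable lborel g"
  shows "(\<integral>z. f (fst z) * g (snd z) \<partial>lborel) = (\<integral>x. f x \<partial>lborel) * (\<integral>y. g y \<partial>lborel)"
    "integrable lborel (\<lambda>z. f (fst z) * g (snd z))"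
proof -
  show int: "integrable lborel (\<lambda>z. f (fst z) * g (snd z))"
    using integrable_tensor[OF f g] by (simp add: lborel_prod case_prod_beta')
  then have "(\<integral>x. \<integral>y. f x * g y \<partial>lborel \<partial>lborel) = (\<integral>z. f (fst z) * g (snd z) \<partial>lborel)"
    using lborel_pair.integral_fst'[of "\<lambda>z. f (fst z) * g (snd z)"] by (simp add: lborel_prod)
  then show "(\<integral>z. f (fst z) * g (snd z) \<partial>lborel) = (\<integral>x. f x \<partial>lborel) * (\<integral>y. g y \<partial>lborel)"
    by simp
qed

text \<open>The transpose of the linearised maximal operator, integrating over the graph x -> (x, Y
  x, T x). It is the bilinear transpose rather than the Hermitian adjoint, hence no conjugate on
  \<open>w\<close> or on the phase.\<close>

definition extension :: "(real \<Rightarrow> 'b::euclidean_space) \<Rightarrow> (real \<Rightarrow> real) \<Rightarrow> (real \<Rightarrow> complex) \<Rightarrow> real \<times> 'b \<Rightarrow> complex" where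
  "extension Y T w \<zeta> = (\<integral>x. w x * cis (zk_phase x (Y x) (T x) \<zeta>) \<partial>lborel)"

context
  fixes Y :: "real \<Rightarrow> 'b::euclidean_space" and T :: "real \<Rightarrow> real"
  assumes meas[measurable]: "Y \<in> borel_measurable borel" "T \<in> borel_measurable borel"
begin

lemma extension_integrable:
  assumes "integrable lborel w"
  shows "integrable lborel (\<lambda>x. w x * cis (zk_phase x (Y x) (T x) \<zeta>))"
proof -
  have [measurable]: "w \<in> borel_measurable borel" using borel_measurable_integrable[OF assms] by simp
  show ?thesis by (rule Bochner_Integration.integrable_bound[OF assms]) (auto simp: norm_mult)
qed

lemma measurable_extension:
  assumes "w \<in> borel_measurable borel"
  shows "extension Y T w \<in> borel_measurable borel"
proof -
  note [measurable] = assms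
  have "(\<lambda>\<zeta>. \<integral>x. w x * cis (zk_phase x (Y x) (T x) \<zeta>) \<partial>lborel) \<in> borel_measurable borel"
    by measurable
  then show ?thesis by (simp add: extension_def[abs_def])
qed

text \<open>The squared modulus is a double integral over x and x'. Linearity of the phase in (x, y,
  t) turns the product of the two exponentials into one exponential at the difference, so
  integrating in \<zeta> first produces the kernel there.\<close>

lemma extension_TT_star:
  assumes w: "integrable lborel w" and \<tau>: "\<tau> > 0"
  shows "(\<integral>\<^sup>+\<zeta>. ennreal (exp (- \<tau> * (norm \<zeta>)\<^sup>2) * (norm (extension Y T w \<zeta>))\<^sup>2) \<partial>lborel)
    \<le> (\<integral>\<^sup>+x. \<integral>\<^sup>+x'. ennreal (norm (w x) * norm (w x') * norm (zk_kernel \<tau> (x - x') (Y x - Y x') (T x - T x'))) \<partial>lborel \<partial>lborel)"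
proof -
  have wm[measurable]: "w \<in> borel_measurable borel" using borel_measurable_integrable[OF w] by simp
  have em[measurable]: "extension Y T w \<in> borel_measurable borel" by (rule measurable_extension[OF wm])
  define W where "W z = w (fst z) * cnj (w (snd z))" for z :: "real \<times> real"
  define ph where "ph z \<zeta> = zk_phase (fst z - snd z) (Y (fst z) - Y (snd z)) (T (fst z) - T (snd z)) \<zeta>" for z \<zeta>
  define e where "e \<zeta> = complex_of_real (exp (- \<tau> * (norm \<zeta>)\<^sup>2))" for \<zeta> :: "real \<times> 'b"
  have Wi: "integrable lborel W"
    unfolding W_def using w by (intro integral_tensor) auto
  have [measurable]: "W \<in> borel_measurable borel" using borel_measurable_integrable[OF Wi] by simp
  have ei: "integrable lborel e"
    unfolding e_def using gauss_integrable_euclidean[OF \<tau>] by (intro integrable_of_real)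
  have [measurable]: "e \<in> borel_measurable borel" using borel_measurable_integrable[OF ei] by simp
  have [measurable]: "(\<lambda>p. ph (fst p) (snd p)) \<in> borel_measurable (borel \<Otimes>\<^sub>M borel)"
    unfolding ph_def by measurable
  have sq: "extension Y T w \<zeta> * cnj (extension Y T w \<zeta>) = (\<integral>z. W z * cis (ph z \<zeta>) \<partial>lborel)" for \<zeta>
  proof -
    define u where "u x = w x * cis (zk_phase x (Y x) (T x) \<zeta>)" for x
    have u: "integrable lborel u" unfolding u_def by (rule extension_integrable[OF w])
    have "extension Y T w \<zeta> * cnj (extension Y T w \<zeta>) = (\<integral>x. u x \<partial>lborel) * (\<integral>x. cnj (u x) \<partial>lborel)"
      by (subst Bochner_Integration.integral_cnj) (simp add: extension_def u_def[abs_def])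
    also have "\<dots> = (\<integral>z. u (fst z) * cnj (u (snd z)) \<partial>lborel)"
      using u by (subst integral_tensor(1)) auto
    also have "\<dots> = (\<integral>z. W z * cis (ph z \<zeta>) \<partial>lborel)"
    proof (rule Bochner_Integration.integral_cong[OF refl])
      fix z :: "real \<times> real"
      have "ph z \<zeta> = zk_phase (fst z) (Y (fst z)) (T (fst z)) \<zeta> - zk_phase (snd z) (Y (snd z)) (T (snd z)) \<zeta>"
        by (simp add: ph_def zk_phase_def inner_diff_left algebra_simps)
      then show "u (fst z) * cnj (u (snd z)) = W z * cis (ph z \<zeta>)"
        by (simp add: u_def W_def cis_diff mult_ac del: cis_cnj)
    qed
    finally show ?thesis .
  qed
  have joint: "integrable (lborel \<Otimes>\<^sub>M lborel) (\<lambda>(z, \<zeta>). W z * (e \<zeta> * cis (ph z \<zeta>)))"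
    by (rule Bochner_Integration.integrable_bound[OF integrable_tensor[OF Wi ei]])
       (auto simp: norm_mult case_prod_beta')
  have K: "(\<integral>\<zeta>. W z * (e \<zeta> * cis (ph z \<zeta>)) \<partial>lborel)
      = W z * zk_kernel \<tau> (fst z - snd z) (Y (fst z) - Y (snd z)) (T (fst z) - T (snd z))" for z
    by (simp add: zk_kernel_def e_def ph_def)
  have "(\<integral>\<^sup>+\<zeta>. ennreal (exp (- \<tau> * (norm \<zeta>)\<^sup>2) * (norm (extension Y T w \<zeta>))\<^sup>2) \<partial>lborel)
      = (\<integral>\<^sup>+\<zeta>. ennreal (norm (e \<zeta> * (extension Y T w \<zeta> * cnj (extension Y T w \<zeta>)))) \<partial>lborel)"
    by (simp add: norm_mult e_def power2_eq_square)
  \<comment> \<open>The integrand is real and nonnegative, so the extended integral is the modulus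
    of a Bochner integral. In that form the order of integration can be exchanged before absolute
    values destroy the oscillation in \<zeta>.\<close>
  also have "\<dots> = ennreal (norm (\<integral>\<zeta>. e \<zeta> * (extension Y T w \<zeta> * cnj (extension Y T w \<zeta>)) \<partial>lborel))"
  proof -
    have nn: "e \<zeta> * (extension Y T w \<zeta> * cnj (extension Y T w \<zeta>)) = of_real (exp (- \<tau> * (norm \<zeta>)\<^sup>2) * (norm (extension Y T w \<zeta>))\<^sup>2)" for \<zeta>
      by (simp only: e_def complex_norm_square of_real_mult)
    have "integrable lborel (\<lambda>\<zeta>. e \<zeta> * (extension Y T w \<zeta> * cnj (extension Y T w \<zeta>)))"
      using lborel_pair.integrable_snd[OF joint] unfolding sq
      by (simp add: mult.left_commute[of _ "e _"])
    then have "integrable lborel (\<lambda>\<zeta>. exp (- \<tau> * (norm \<zeta>)\<^sup>2) * (norm (extension Y T w \<zeta>))\<^sup>2)"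
      unfolding nn by (simp only: integrable_of_real complex_of_real_integrable_eq)
    then show ?thesis
      unfolding nn norm_of_real integral_complex_of_real
      by (simp add: nn_integral_eq_integral abs_of_nonneg integral_nonneg_AE)
  qed
  also have "(\<integral>\<zeta>. e \<zeta> * (extension Y T w \<zeta> * cnj (extension Y T w \<zeta>)) \<partial>lborel) = (\<integral>\<zeta>. \<integral>z. W z * (e \<zeta> * cis (ph z \<zeta>)) \<partial>lborel \<partial>lborel)"
    unfolding sq by (simp add: mult.left_commute[of _ "e _"])
  also have "\<dots> = (\<integral>z. \<integral>\<zeta>. W z * (e \<zeta> * cis (ph z \<zeta>)) \<partial>lborel \<partial>lborel)"
    by (rule lborel_pair.Fubini_integral) (rule joint)
  also have "ennreal (norm \<dots>) \<le> (\<integral>\<^sup>+z. ennreal (norm (\<integral>\<zeta>. W z * (e \<zeta> * cis (ph z \<zeta>)) \<partial>lborel)) \<partial>lborel)"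
    using lborel_pair.integrable_fst[OF joint] by (intro integral_norm_bound_ennreal) simp
  also have "\<dots> = (\<integral>\<^sup>+z. ennreal (norm (\<integral>\<zeta>. W z * (e \<zeta> * cis (ph z \<zeta>)) \<partial>lborel)) \<partial>(lborel \<Otimes>\<^sub>M lborel))"
    by (simp add: lborel_prod)
  also have "\<dots> = (\<integral>\<^sup>+x. \<integral>\<^sup>+x'. ennreal (norm (w x) * norm (w x') * norm (zk_kernel \<tau> (x - x') (Y x - Y x') (T x - T x'))) \<partial>lborel \<partial>lborel)"
    unfolding K by (subst lborel.nn_integral_fst[symmetric]) (simp_all add: W_def norm_mult)
  finally show ?thesis .
qed

end

section \<open>From Gaussian cutoffs to the Sobolev weight\<close>

lemma powr_power_nonneg:
  fixes x a :: real
  assumes "x \<ge> 0" "n > 0"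
  shows "(x powr a) ^ n = x powr (real n * a)"
  using assms by (cases "x = 0") (auto simp: powr_power)

lemma nn_integral_Gamma_scale:
  fixes a s :: real
  assumes s: "s > 0" and a: "a > 0"
  shows "(\<integral>\<^sup>+\<tau>. ennreal (indicator {0<..} \<tau> * (\<tau> powr (s - 1) * exp (- a * \<tau>))) \<partial>lborel) = ennreal (Gamma s * a powr (- s))"
proof -
  let ?f = "\<lambda>\<tau>. ennreal (indicator {0..} \<tau> * \<tau> powr (s - 1) / exp \<tau>)"
  have "ennreal (Gamma s) = ennreal a * (\<integral>\<^sup>+\<tau>. ?f (a * \<tau>) \<partial>lborel)"
    using Gamma_conv_nn_integral_real[OF s] nn_integral_real_affine[of ?f a 0] a by simp
  \<comment> \<open>Closed and open half-line may be interchanged here because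
    \<open>0 powr x = 0\<close>.\<close>
  also have "(\<integral>\<^sup>+\<tau>. ?f (a * \<tau>) \<partial>lborel)
     = (\<integral>\<^sup>+\<tau>. ennreal (a powr (s - 1)) * ennreal (indicator {0<..} \<tau> * (\<tau> powr (s - 1) * exp (- a * \<tau>))) \<partial>lborel)"
    using a by (intro nn_integral_cong)
      (auto simp: indicator_def powr_mult exp_minus field_simps zero_le_mult_iff simp flip: ennreal_mult')
  also have "\<dots> = ennreal (a powr (s - 1)) * (\<integral>\<^sup>+\<tau>. ennreal (indicator {0<..} \<tau> * (\<tau> powr (s - 1) * exp (- a * \<tau>))) \<partial>lborel)"
    by (rule nn_integral_cmult) measurable
  finally have "ennreal (a powr (- s)) * ennreal (Gamma s) = ennreal (a powr (- s)) * (ennreal a * (ennreal (a powr (s - 1)) *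
     (\<integral>\<^sup>+\<tau>. ennreal (indicator {0<..} \<tau> * (\<tau> powr (s - 1) * exp (- a * \<tau>))) \<partial>lborel)))" by simp
  also have "\<dots> = ennreal (a powr (- s) * (a * a powr (s - 1))) *
     (\<integral>\<^sup>+\<tau>. ennreal (indicator {0<..} \<tau> * (\<tau> powr (s - 1) * exp (- a * \<tau>))) \<partial>lborel)"
    using a by (simp add: ennreal_mult mult.assoc)
  also have "a powr (- s) * (a * a powr (s - 1)) = 1"
    using a by (simp add: powr_diff powr_minus)
  finally show ?thesis using a by (simp add: ennreal_mult' mult.commute[of "Gamma s"])
qed

text \<open>\<open>p powr (3/2)\<close> is the square of the L^(4/3) norm of \<open>w\<close>. With
  c = \<tau> powr (-1/2) and D = DIM('b) + 1, the kernel contributes c^D and the L^2 norm of the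
  majorant dilated by c contributes c powr (-1/2); together they are \<tau> powr -(D/2 - 1/4). The
  constant is fixed before \<open>Y\<close> and \<open>T\<close>, which later depend on the
  datum.\<close>

lemma extension_gauss_bound:
  assumes dim: "DIM('b::euclidean_space) \<ge> 2"
  shows "\<exists>A\<ge>0. \<forall>(Y :: real \<Rightarrow> 'b) T w p \<tau>. Y \<in> borel_measurable borel \<longrightarrow> T \<in> borel_measurable borel \<longrightarrow>
      integrable lborel w \<longrightarrow> p \<ge> 0 \<longrightarrow> (\<integral>\<^sup>+x. ennreal (norm (w x) powr (4/3)) \<partial>lborel) = ennreal p \<longrightarrow> \<tau> > 0 \<longrightarrow>
      (\<integral>\<^sup>+\<zeta>. ennreal (exp (- \<tau> * (norm \<zeta>)\<^sup>2) * (norm (extension Y T w \<zeta>))\<^sup>2) \<partial>lborel)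
        \<le> ennreal (A * p powr (3/2) * \<tau> powr (- ((DIM('b) + 1) / 2 - 1 / 4)))"
proof -
  obtain A where A: "A \<ge> 0" "\<And>x (y::'b) t. norm (zk_kernel 1 x y t) \<le> A * zk_majorant x"
    using zk_kernel_one_bound[OF dim] by blast
  obtain B where B: "B \<ge> 0" "(\<integral>\<^sup>+x. ennreal ((zk_majorant x)\<^sup>2) \<partial>lborel) = ennreal B"
    using zk_majorant_square_integrable by (metis ennreal_cases infinity_ennreal_def less_irrefl)
  show ?thesis
  proof (intro exI[of _ "A * sqrt B"] conjI allI impI)
    show "A * sqrt B \<ge> 0" using A B by simp
    fix Y :: "real \<Rightarrow> 'b" and T :: "real \<Rightarrow> real" and w :: "real \<Rightarrow> complex" and p \<tau> :: real
    assume [measurable]: "Y \<in> borel_measurable borel" "T \<in> borel_measurable borel"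
      and w: "integrable lborel w"
      and p0: "p \<ge> 0" and p43: "(\<integral>\<^sup>+x. ennreal (norm (w x) powr (4/3)) \<partial>lborel) = ennreal p" and \<tau>: "\<tau> > 0"
    have [measurable]: "w \<in> borel_measurable borel" using borel_measurable_integrable[OF w] by simp
    \<comment> \<open>The cube root makes both |w| = v^3 and |w| powr (4/3) = v^4 integral powers,
      as \<open>nn_integral_young\<close> expects.\<close>
    define v where "v x = norm (w x) powr (1/3)" for x
    have [measurable]: "v \<in> borel_measurable borel" unfolding v_def by measurable
    have v: "v x \<ge> 0" "norm (w x) = v x ^ 3" for x
      by (simp_all add: v_def powr_power_nonneg)
    have p: "p \<ge> 0" "(\<integral>\<^sup>+x. ennreal (v x ^ 4) \<partial>lborel) = ennreal p"
      using p0 p43 by (simp_all add: v_def powr_power_nonneg)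
    define c where "c = 1 / sqrt \<tau>"
    define D where "D = DIM('b) + 1"
    have c: "c > 0" using \<tau> by (simp add: c_def)
    have c\<tau>: "\<tau> = 1 / c\<^sup>2" using \<tau> by (simp add: c_def power_divide)
    have c_powr: "c = \<tau> powr (- (1/2))" using \<tau> by (simp add: c_def powr_minus_divide powr_half_sqrt)
    let ?X = "\<integral>\<^sup>+\<zeta>. ennreal (exp (- \<tau> * (norm \<zeta>)\<^sup>2) * (norm (extension Y T w \<zeta>))\<^sup>2) \<partial>lborel"
    let ?g = "\<lambda>u. ennreal (A * c ^ D * zk_majorant (c * u))"
    have K: "norm (zk_kernel \<tau> x (y::'b) t) \<le> A * c ^ D * zk_majorant (c * x)" for x y t
    proof -
      have "norm (zk_kernel \<tau> x y t) = c ^ D * norm (zk_kernel 1 (c * x) (c *\<^sub>R y) (c ^ 3 * t))"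
        unfolding c\<tau> zk_kernel_scale[OF c] D_def using c by (simp add: norm_mult norm_power)
      also have "\<dots> \<le> c ^ D * (A * zk_majorant (c * x))"
        using c A by (intro mult_left_mono) auto
      finally show ?thesis by (simp add: mult_ac)
    qed
    have "?X \<le> (\<integral>\<^sup>+x. \<integral>\<^sup>+x'. ennreal (norm (w x) * norm (w x') * norm (zk_kernel \<tau> (x - x') (Y x - Y x') (T x - T x'))) \<partial>lborel \<partial>lborel)"
      by (rule extension_TT_star) (use w \<tau> in auto)
    also have "\<dots> \<le> (\<integral>\<^sup>+x. \<integral>\<^sup>+x'. ennreal (v x) ^ 3 * ennreal (v x') ^ 3 * ?g (x - x') \<partial>lborel \<partial>lborel)"
    proof (intro nn_integral_mono)
      fix x x'
      have "norm (w x) * norm (w x') * norm (zk_kernel \<tau> (x - x') (Y x - Y x') (T x - T x'))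
        \<le> v x ^ 3 * v x' ^ 3 * (A * c ^ D * zk_majorant (c * (x - x')))"
        unfolding v(2) using v(1) by (intro mult_left_mono K) auto
      then have "ennreal (norm (w x) * norm (w x') * norm (zk_kernel \<tau> (x - x') (Y x - Y x') (T x - T x')))
        \<le> ennreal (v x ^ 3 * v x' ^ 3 * (A * c ^ D * zk_majorant (c * (x - x'))))"
        by (rule ennreal_leI)
      also have "\<dots> = ennreal (v x) ^ 3 * ennreal (v x') ^ 3 * ?g (x - x')"
        using v(1) A(1) c zk_majorant_nonneg by (simp add: ennreal_mult' ennreal_power)
      finally show "ennreal (norm (w x) * norm (w x') * norm (zk_kernel \<tau> (x - x') (Y x - Y x') (T x - T x')))
        \<le> ennreal (v x) ^ 3 * ennreal (v x') ^ 3 * ?g (x - x')" .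
    qed
    finally have "?X\<^sup>2 \<le> (\<integral>\<^sup>+x. \<integral>\<^sup>+x'. ennreal (v x) ^ 3 * ennreal (v x') ^ 3 * ?g (x - x') \<partial>lborel \<partial>lborel)\<^sup>2"
      by (rule power_mono) simp
    also have "\<dots> \<le> (\<integral>\<^sup>+x. ennreal (v x) ^ 4 \<partial>lborel) ^ 3 * (\<integral>\<^sup>+u. (?g u)\<^sup>2 \<partial>lborel)"
      by (rule nn_integral_young) measurable
    also have "(\<integral>\<^sup>+x. ennreal (v x) ^ 4 \<partial>lborel) = ennreal p"
      using v(1) p by (simp add: ennreal_power)
    also have "(\<integral>\<^sup>+u. (?g u)\<^sup>2 \<partial>lborel) = ennreal (A\<^sup>2 * c ^ (2 * D) * (B / c))"
    proof -
      have "ennreal B = ennreal c * (\<integral>\<^sup>+u. ennreal ((zk_majorant (c * u))\<^sup>2) \<partial>lborel)"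
        using B(2) nn_integral_real_affine[of "\<lambda>u. ennreal ((zk_majorant u)\<^sup>2)" c 0] c by simp
      then have "ennreal (1 / c) * ennreal B = (ennreal (1 / c) * ennreal c) * (\<integral>\<^sup>+u. ennreal ((zk_majorant (c * u))\<^sup>2) \<partial>lborel)"
        by (simp only: mult.assoc)
      also have "ennreal (1 / c) * ennreal c = 1" using c by (simp flip: ennreal_mult')
      finally have scaled: "(\<integral>\<^sup>+u. ennreal ((zk_majorant (c * u))\<^sup>2) \<partial>lborel) = ennreal (B / c)"
        using ennreal_mult'[of "1 / c" B] c by simp
      have "(\<integral>\<^sup>+u. (?g u)\<^sup>2 \<partial>lborel) = (\<integral>\<^sup>+u. ennreal (A\<^sup>2 * c ^ (2 * D)) * ennreal ((zk_majorant (c * u))\<^sup>2) \<partial>lborel)"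
      proof (rule nn_integral_cong)
        fix u
        have "(?g u)\<^sup>2 = ennreal ((A * c ^ D * zk_majorant (c * u))\<^sup>2)"
          using A(1) c zk_majorant_nonneg by (intro ennreal_power) auto
        also have "(A * c ^ D * zk_majorant (c * u))\<^sup>2 = A\<^sup>2 * c ^ (2 * D) * (zk_majorant (c * u))\<^sup>2"
          by (simp add: power_mult_distrib power_mult[symmetric] mult.commute[of D])
        also have "ennreal \<dots> = ennreal (A\<^sup>2 * c ^ (2 * D)) * ennreal ((zk_majorant (c * u))\<^sup>2)"
          by (rule ennreal_mult) (use c in auto)
        finally show "(?g u)\<^sup>2 = ennreal (A\<^sup>2 * c ^ (2 * D)) * ennreal ((zk_majorant (c * u))\<^sup>2)" .
      qed
      also have "\<dots> = ennreal (A\<^sup>2 * c ^ (2 * D)) * ennreal (B / c)"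
        unfolding scaled[symmetric] by (rule nn_integral_cmult) measurable
      also have "\<dots> = ennreal (A\<^sup>2 * c ^ (2 * D) * (B / c))"
        by (rule ennreal_mult[symmetric]) (use B(1) c in auto)
      finally show ?thesis .
    qed
    also have "ennreal p ^ 3 * ennreal (A\<^sup>2 * c ^ (2 * D) * (B / c))
       = (ennreal (A * sqrt B * p powr (3/2) * \<tau> powr (- ((DIM('b) + 1) / 2 - 1 / 4))))\<^sup>2"
    proof -
      define e where "e = - ((DIM('b) + 1) / 2 - (1 / 4 :: real))"
      have "(p powr (3/2))\<^sup>2 = p powr 3" using powr_power_nonneg[of p 2 "3/2"] p(1) by simp
      also have "\<dots> = p ^ 3" using p(1) by simp
      finally have p3: "(p powr (3/2))\<^sup>2 = p ^ 3" .
      have "(\<tau> powr e)\<^sup>2 = \<tau> powr (real 2 * e)" by (rule powr_power_nonneg) (use \<tau> in auto)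
      also have "real 2 * e = - real D - (- (1/2))" by (simp add: e_def D_def field_simps)
      also have "\<tau> powr \<dots> = \<tau> powr (- real D) / c" unfolding powr_diff c_powr ..
      also have "\<tau> powr (- real D) = c ^ (2 * D)"
        using \<tau> by (simp add: c_def power_mult power_divide powr_minus_divide powr_realpow)
      finally have "(A * sqrt B * p powr (3/2) * \<tau> powr e)\<^sup>2 = p ^ 3 * (A\<^sup>2 * c ^ (2 * D) * (B / c))"
        using B(1) p3 by (simp add: power_mult_distrib)
      moreover have "(ennreal (A * sqrt B * p powr (3/2) * \<tau> powr e))\<^sup>2 = ennreal ((A * sqrt B * p powr (3/2) * \<tau> powr e)\<^sup>2)"
        using A(1) B(1) by (intro ennreal_power) auto
      moreover have "ennreal (p ^ 3 * (A\<^sup>2 * c ^ (2 * D) * (B / c))) = ennreal (p ^ 3) * ennreal (A\<^sup>2 * c ^ (2 * D) * (B / c))"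
        by (rule ennreal_mult) (use p(1) B(1) c in auto)
      moreover have "ennreal (p ^ 3) = ennreal p ^ 3" using p(1) by (simp add: ennreal_power)
      ultimately show ?thesis by (simp only: e_def)
    qed
    finally show "?X \<le> ennreal (A * sqrt B * p powr (3/2) * \<tau> powr (- ((DIM('b) + 1) / 2 - 1 / 4)))"
      by (rule ennreal_power2_le_imp_le)
  qed
qed

text \<open>
  The Sobolev weight is a superposition of Gaussians,
  \<open>\<Gamma>(s)(1 + \<bar>\<zeta>\<bar>\<^sup>2)\<^sup>-\<^sup>s = \<integral> \<tau>\<^sup>s\<^sup>-\<^sup>1 exp (- \<tau>(1 + \<bar>\<zeta>\<bar>\<^sup>2)) d\<tau>\<close>, and the
  integral over \<open>\<tau>\<close> of the Gaussian bounds converges exactly for \<open>s > d/2 - 1/4\<close>.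
\<close>

lemma extension_sobolev_bound:
  assumes dim: "DIM('b::euclidean_space) \<ge> 2" and s: "s > (DIM('b) + 1) / 2 - 1 / 4"
  shows "\<exists>A\<ge>0. \<forall>(Y :: real \<Rightarrow> 'b) T w p. Y \<in> borel_measurable borel \<longrightarrow> T \<in> borel_measurable borel \<longrightarrow>
      integrable lborel w \<longrightarrow> p \<ge> 0 \<longrightarrow> (\<integral>\<^sup>+x. ennreal (norm (w x) powr (4/3)) \<partial>lborel) = ennreal p \<longrightarrow>
      (\<integral>\<^sup>+\<zeta>. ennreal ((1 + (norm \<zeta>)\<^sup>2) powr (- s) * (norm (extension Y T w \<zeta>))\<^sup>2) \<partial>lborel)
        \<le> ennreal (A * p powr (3/2))"
proof -
  define \<sigma> where "\<sigma> = (DIM('b) + 1) / 2 - (1 / 4 :: real)"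
  have \<sigma>: "\<sigma> > 0" "s > \<sigma>" using s dim by (auto simp: \<sigma>_def)
  then have "s > 0" by linarith
  note \<sigma> = \<sigma> this
  obtain A where A: "A \<ge> 0" and bound: "\<And>(Y :: real \<Rightarrow> 'b) T w p \<tau>. Y \<in> borel_measurable borel \<Longrightarrow>
      T \<in> borel_measurable borel \<Longrightarrow> integrable lborel w \<Longrightarrow> p \<ge> 0 \<Longrightarrow>
      (\<integral>\<^sup>+x. ennreal (norm (w x) powr (4/3)) \<partial>lborel) = ennreal p \<Longrightarrow> \<tau> > 0 \<Longrightarrow>
      (\<integral>\<^sup>+\<zeta>. ennreal (exp (- \<tau> * (norm \<zeta>)\<^sup>2) * (norm (extension Y T w \<zeta>))\<^sup>2) \<partial>lborel)
        \<le> ennreal (A * p powr (3/2) * \<tau> powr (- \<sigma>))"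
    using extension_gauss_bound[OF dim] unfolding \<sigma>_def by blast
  have G: "Gamma s > 0" "Gamma (s - \<sigma>) > 0" using \<sigma> by (auto intro: Gamma_real_pos)
  show ?thesis
  proof (intro exI[of _ "A * Gamma (s - \<sigma>) / Gamma s"] conjI allI impI)
    show "A * Gamma (s - \<sigma>) / Gamma s \<ge> 0" using A G by simp
    fix Y :: "real \<Rightarrow> 'b" and T :: "real \<Rightarrow> real" and w :: "real \<Rightarrow> complex" and p :: real
    assume YT[measurable]: "Y \<in> borel_measurable borel" "T \<in> borel_measurable borel"
      and w: "integrable lborel w"
      and p: "p \<ge> 0" "(\<integral>\<^sup>+x. ennreal (norm (w x) powr (4/3)) \<partial>lborel) = ennreal p"
    have [measurable]: "w \<in> borel_measurable borel" using borel_measurable_integrable[OF w] by simp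
    have [measurable]: "extension Y T w \<in> borel_measurable borel" by (rule measurable_extension) measurable
    let ?h = "\<lambda>\<zeta>. ennreal ((norm (extension Y T w \<zeta>))\<^sup>2)"
    let ?i = "\<lambda>\<tau>::real. indicator {0<..} \<tau> :: real"
    let ?M = "\<integral>\<^sup>+\<zeta>. ennreal ((1 + (norm \<zeta>)\<^sup>2) powr (- s) * (norm (extension Y T w \<zeta>))\<^sup>2) \<partial>lborel"
    have "ennreal (Gamma s) * ?M = (\<integral>\<^sup>+\<zeta>. ennreal (Gamma s * (1 + (norm \<zeta>)\<^sup>2) powr (- s)) * ?h \<zeta> \<partial>lborel)"
      using G by (subst nn_integral_cmult[symmetric]) (auto simp: ennreal_mult'[symmetric] mult.assoc intro!: nn_integral_cong)
    also have "\<dots> = (\<integral>\<^sup>+\<zeta>. \<integral>\<^sup>+\<tau>. ennreal (?i \<tau> * (\<tau> powr (s - 1) * exp (- (1 + (norm \<zeta>)\<^sup>2) * \<tau>))) * ?h \<zeta> \<partial>lborel \<partial>lborel)"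
    proof (rule nn_integral_cong)
      fix \<zeta> :: "real \<times> 'b"
      have "1 + (norm \<zeta>)\<^sup>2 > 0" by (simp add: add_pos_nonneg)
      from nn_integral_Gamma_scale[OF \<sigma>(3) this]
      show "ennreal (Gamma s * (1 + (norm \<zeta>)\<^sup>2) powr (- s)) * ?h \<zeta> =
          (\<integral>\<^sup>+\<tau>. ennreal (?i \<tau> * (\<tau> powr (s - 1) * exp (- (1 + (norm \<zeta>)\<^sup>2) * \<tau>))) * ?h \<zeta> \<partial>lborel)"
        by (subst nn_integral_multc) simp_all
    qed
    also have "\<dots> = (\<integral>\<^sup>+\<tau>. \<integral>\<^sup>+\<zeta>. ennreal (?i \<tau> * (\<tau> powr (s - 1) * exp (- (1 + (norm \<zeta>)\<^sup>2) * \<tau>))) * ?h \<zeta> \<partial>lborel \<partial>lborel)"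
      by (rule lborel_pair.Fubini') measurable
    \<comment> \<open>The exponential splits into exp (-\<tau>) and the Gaussian cutoff. The bound
      for the cutoff lowers the exponent from s - 1 to s - \<sigma> - 1, and the remaining
      \<tau>-integral is again a Gamma integral because s > \<sigma>.\<close>
    also have "\<dots> \<le> (\<integral>\<^sup>+\<tau>. ennreal (A * p powr (3/2)) * ennreal (?i \<tau> * (\<tau> powr ((s - \<sigma>) - 1) * exp (- 1 * \<tau>))) \<partial>lborel)"
    proof (rule nn_integral_mono)
      fix \<tau> :: real
      show "(\<integral>\<^sup>+\<zeta>. ennreal (?i \<tau> * (\<tau> powr (s - 1) * exp (- (1 + (norm \<zeta>)\<^sup>2) * \<tau>))) * ?h \<zeta> \<partial>lborel)
        \<le> ennreal (A * p powr (3/2)) * ennreal (?i \<tau> * (\<tau> powr ((s - \<sigma>) - 1) * exp (- 1 * \<tau>)))"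
      proof (cases "\<tau> > 0")
        case True
        have "(\<integral>\<^sup>+\<zeta>. ennreal (?i \<tau> * (\<tau> powr (s - 1) * exp (- (1 + (norm \<zeta>)\<^sup>2) * \<tau>))) * ?h \<zeta> \<partial>lborel)
          = (\<integral>\<^sup>+\<zeta>. ennreal (\<tau> powr (s - 1) * exp (- \<tau>)) * ennreal (exp (- \<tau> * (norm \<zeta>)\<^sup>2) * (norm (extension Y T w \<zeta>))\<^sup>2) \<partial>lborel)"
          using True by (intro nn_integral_cong)
            (auto simp: ennreal_mult'[symmetric] exp_add[symmetric] algebra_simps)
        also have "\<dots> = ennreal (\<tau> powr (s - 1) * exp (- \<tau>)) *
            (\<integral>\<^sup>+\<zeta>. ennreal (exp (- \<tau> * (norm \<zeta>)\<^sup>2) * (norm (extension Y T w \<zeta>))\<^sup>2) \<partial>lborel)"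
          by (rule nn_integral_cmult) measurable
        also have "\<dots> \<le> ennreal (\<tau> powr (s - 1) * exp (- \<tau>)) * ennreal (A * p powr (3/2) * \<tau> powr (- \<sigma>))"
          by (intro mult_left_mono bound[OF YT w p True]) auto
        also have "\<dots> = ennreal (A * p powr (3/2)) * ennreal (?i \<tau> * (\<tau> powr ((s - \<sigma>) - 1) * exp (- 1 * \<tau>)))"
        proof -
          have "\<tau> powr ((s - \<sigma>) - 1) = \<tau> powr (s - 1) * \<tau> powr (- \<sigma>)"
            unfolding powr_add[symmetric] by (simp add: algebra_simps)
          then show ?thesis using True A by (simp add: ennreal_mult'[symmetric] mult_ac)
        qed
        finally show ?thesis .
      qed simp
    qed
    also have "\<dots> = ennreal (A * p powr (3/2)) * ennreal (Gamma (s - \<sigma>) * 1 powr (- (s - \<sigma>)))"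
      using \<sigma> by (subst nn_integral_cmult, measurable) (subst nn_integral_Gamma_scale, auto)
    also have "\<dots> = ennreal (A * p powr (3/2) * Gamma (s - \<sigma>))" using A by (simp add: ennreal_mult')
    finally have "ennreal (1 / Gamma s) * (ennreal (Gamma s) * ?M) \<le> ennreal (1 / Gamma s) * ennreal (A * p powr (3/2) * Gamma (s - \<sigma>))"
      by (rule mult_left_mono) simp
    also have "\<dots> = ennreal (1 / Gamma s * (A * p powr (3/2) * Gamma (s - \<sigma>)))"
      using G by (intro ennreal_mult'[symmetric]) simp
    also have "1 / Gamma s * (A * p powr (3/2) * Gamma (s - \<sigma>)) = A * Gamma (s - \<sigma>) / Gamma s * p powr (3/2)"
      by simp
    also have "ennreal (1 / Gamma s) * (ennreal (Gamma s) * ?M) = ennreal (1 / Gamma s * Gamma s) * ?M"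
      using G by (subst ennreal_mult') (simp_all only: mult.assoc, simp)
    also have "ennreal (1 / Gamma s * Gamma s) = 1" using G by simp
    finally show "?M \<le> ennreal (A * Gamma (s - \<sigma>) / Gamma s * p powr (3/2))" by simp
  qed
qed

section \<open>The maximal function\<close>

text \<open>A phase can be undone by the opposite phase, so integrability of an oscillating
  integrand does not depend on x, y or t.\<close>

lemma integrable_mult_cis_iff:
  fixes f :: "'a::euclidean_space \<Rightarrow> complex"
  assumes [measurable]: "ph \<in> borel_measurable borel"
  shows "integrable lborel (\<lambda>\<zeta>. f \<zeta> * cis (ph \<zeta>)) \<longleftrightarrow> integrable lborel f"
proof -
  have step: "integrable lborel (\<lambda>\<zeta>. g \<zeta> * cis (ps \<zeta>))"
    if g: "integrable lborel g" and [measurable]: "ps \<in> borel_measurable borel"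
    for g :: "'a \<Rightarrow> complex" and ps :: "'a \<Rightarrow> real"
  proof -
    have [measurable]: "g \<in> borel_measurable borel" using borel_measurable_integrable[OF g] by simp
    show ?thesis by (rule Bochner_Integration.integrable_bound[OF g]) (auto simp: norm_mult)
  qed
  have "integrable lborel f" if "integrable lborel (\<lambda>\<zeta>. f \<zeta> * cis (ph \<zeta>))"
    using step[OF that, of "\<lambda>\<zeta>. - ph \<zeta>"] by (simp add: mult.assoc cis_mult)
  then show ?thesis using step by auto
qed

lemma U_eq_integral:
  fixes u0 :: "real \<times> (real ^ 'n) \<Rightarrow> complex"
  shows "U t u0 (x, y) = of_real (1 / (2 * pi) ^ DIM(real \<times> (real ^ 'n))) * (\<integral>\<zeta>. fourier u0 \<zeta> * cis (zk_phase x y t \<zeta>) \<partial>lborel)"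
proof -
  have "exp (\<i> * complex_of_real ((x, y) \<bullet> \<zeta>)) *
      (case \<zeta> of (\<xi>, \<eta>) \<Rightarrow> exp (\<i> * complex_of_real (t * \<xi> * (\<xi>\<^sup>2 + (norm \<eta>)\<^sup>2))) * fourier u0 (\<xi>, \<eta>))
    = fourier u0 \<zeta> * cis (zk_phase x y t \<zeta>)" for \<zeta>
    by (cases \<zeta>) (simp add: zk_phase_Pair cis_conv_exp exp_add[symmetric] distrib_left mult_ac)
  then show ?thesis unfolding U_def inv_fourier_def by simp
qed

text \<open>The Bochner integral of a non-integrable function is 0 by convention, and the phase does
  not affect integrability.\<close>

lemma U_eq_0:
  assumes "\<not> integrable lborel (fourier u0)"
  shows "U t u0 (x, y) = 0"
  using assms unfolding U_eq_integral
  by (subst not_integrable_integral_eq) (auto simp: integrable_mult_cis_iff)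

text \<open>
  The maximal function is linearised: \<open>Y x\<close> and \<open>T x\<close> stand for the point where the supremum
  over \<open>(y, t)\<close> is attained, and \<open>w\<close> is the dual function of \<open>F\<close> in \<open>L\<^sup>4\<close>.
\<close>

lemma linearized_maximal_estimate:
  assumes dim: "CARD('n::finite) \<ge> 2" and s: "s > (CARD('n) + 1) / 2 - 1 / 4"
  shows "\<exists>C\<ge>0. \<forall>(u0 :: real \<times> (real ^ 'n) \<Rightarrow> complex) Y T R \<sigma>. integrable lborel (fourier u0) \<longrightarrow>
      Y \<in> borel_measurable borel \<longrightarrow> T \<in> borel_measurable borel \<longrightarrow> \<sigma> \<ge> 0 \<longrightarrow>
      (\<integral>\<^sup>+\<zeta>. ennreal ((1 + (norm \<zeta>)\<^sup>2) powr s * (norm (fourier u0 \<zeta>))\<^sup>2) \<partial>lborel) = ennreal \<sigma> \<longrightarrow>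
      (\<integral>\<^sup>+x. ennreal (indicator {-R..R} x * norm (U (T x) u0 (x, Y x)) ^ 4) \<partial>lborel) \<le> ennreal ((C * \<sigma>)\<^sup>2)"
proof -
  have "DIM(real ^ 'n) \<ge> 2" "s > (DIM(real ^ 'n) + 1) / 2 - 1 / 4" using dim s by simp_all
  from extension_sobolev_bound[OF this]
  obtain A where A: "A \<ge> 0" and bound: "\<And>(Y :: real \<Rightarrow> real ^ 'n) T w p. Y \<in> borel_measurable borel \<Longrightarrow>
      T \<in> borel_measurable borel \<Longrightarrow> integrable lborel w \<Longrightarrow> p \<ge> 0 \<Longrightarrow>
      (\<integral>\<^sup>+x. ennreal (norm (w x) powr (4/3)) \<partial>lborel) = ennreal p \<Longrightarrow>
      (\<integral>\<^sup>+\<zeta>. ennreal ((1 + (norm \<zeta>)\<^sup>2) powr (- s) * (norm (extension Y T w \<zeta>))\<^sup>2) \<partial>lborel)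
        \<le> ennreal (A * p powr (3/2))" by blast
  define k where "k = 1 / (2 * pi) ^ DIM(real \<times> (real ^ 'n))"
  have k: "k > 0" by (simp add: k_def)
  show ?thesis
  proof (intro exI[of _ "k\<^sup>2 * A"] conjI allI impI)
    show "k\<^sup>2 * A \<ge> 0" using A by simp
    fix u0 :: "real \<times> (real ^ 'n) \<Rightarrow> complex" and Y :: "real \<Rightarrow> real ^ 'n" and T :: "real \<Rightarrow> real" and R \<sigma> :: real
    assume f: "integrable lborel (fourier u0)"
      and YT[measurable]: "Y \<in> borel_measurable borel" "T \<in> borel_measurable borel"
      and \<sigma>: "\<sigma> \<ge> 0" and S: "(\<integral>\<^sup>+\<zeta>. ennreal ((1 + (norm \<zeta>)\<^sup>2) powr s * (norm (fourier u0 \<zeta>))\<^sup>2) \<partial>lborel) = ennreal \<sigma>"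
    define f where "f = fourier u0"
    note f = f[folded f_def] and S = S[folded f_def]
    have [measurable]: "f \<in> borel_measurable borel" using borel_measurable_integrable[OF f] by simp
    define F where "F x = U (T x) u0 (x, Y x)" for x
    have F: "F x = of_real k * (\<integral>\<zeta>. f \<zeta> * cis (zk_phase x (Y x) (T x) \<zeta>) \<partial>lborel)" for x
      unfolding F_def U_eq_integral k_def f_def ..
    have [measurable]: "F \<in> borel_measurable borel" unfolding F by measurable
    \<comment> \<open>This bound on \<open>F\<close>, combined with the window [-R, R], makes
      \<open>p\<close> below finite, which is what later permits division by
      \<open>p powr (3/2)\<close>. Neither \<open>N\<close> nor R enters the final constant.\<close>
    define N where "N = k * (\<integral>\<zeta>. norm (f \<zeta>) \<partial>lborel)"
    have FN: "norm (F x) \<le> N" for x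
    proof -
      have "norm (F x) = k * norm (\<integral>\<zeta>. f \<zeta> * cis (zk_phase x (Y x) (T x) \<zeta>) \<partial>lborel)"
        unfolding F using k by (simp add: norm_mult)
      also have "\<dots> \<le> k * (\<integral>\<zeta>. norm (f \<zeta> * cis (zk_phase x (Y x) (T x) \<zeta>)) \<partial>lborel)"
        using k by (intro mult_left_mono integral_norm_bound) auto
      finally show ?thesis by (simp add: N_def norm_mult)
    qed
    have bdd: "integrable lborel g" if "g \<in> borel_measurable borel" "\<And>x. norm (g x) \<le> indicator {-R..R} x * b"
      for g :: "real \<Rightarrow> complex" and b
    proof (rule Bochner_Integration.integrable_bound)
      show "integrable lborel (\<lambda>x. indicator {-R..R} x * b)"
        by (intro integrable_mult_left integrable_real_indicator) (auto simp: emeasure_lborel_Icc_eq)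
      show "AE x in lborel. norm (g x) \<le> norm (indicator {-R..R} x * b)"
        using order_trans[OF that(2) abs_ge_self] by simp
    qed (use that in auto)
    \<comment> \<open>With this choice the integrals of \<open>w x * F x\<close> and of
      \<open>norm (w x) powr (4/3)\<close> are both equal to \<open>p\<close>.\<close>
    define w where "w x = of_real (indicator {-R..R} x * (norm (F x))\<^sup>2) * cnj (F x)" for x
    have nw: "norm (w x) = indicator {-R..R} x * norm (F x) ^ 3" for x
      by (simp add: w_def norm_mult power2_eq_square power3_eq_cube)
    have wm[measurable]: "w \<in> borel_measurable borel" unfolding w_def by measurable
    have w: "integrable lborel w"
      by (rule bdd[of _ "N ^ 3"]) (use FN in \<open>auto simp: nw intro!: mult_left_mono power_mono\<close>)
    have wF: "w x * F x = of_real (indicator {-R..R} x * norm (F x) ^ 4)" for x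
    proof -
      have "cnj (F x) * F x = of_real ((norm (F x))\<^sup>2)" by (metis complex_norm_square mult.commute)
      then have "w x * F x = of_real (indicator {-R..R} x * (norm (F x))\<^sup>2) * of_real ((norm (F x))\<^sup>2)"
        by (simp only: w_def mult.assoc)
      then show ?thesis by (simp add: power4_eq_xxxx power2_eq_square)
    qed
    have wFi: "integrable lborel (\<lambda>x. w x * F x)"
      by (rule bdd[of _ "N ^ 4"]) (use FN in \<open>auto simp: wF norm_mult norm_power simp del: of_real_mult of_real_power intro!: mult_left_mono power_mono\<close>)
    define p where "p = (\<integral>x. indicator {-R..R} x * norm (F x) ^ 4 \<partial>lborel)"
    have p: "p \<ge> 0" unfolding p_def by (intro integral_nonneg_AE) auto
    have i4: "integrable lborel (\<lambda>x. indicator {-R..R} x * norm (F x) ^ 4)"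
      using wFi unfolding wF complex_of_real_integrable_eq .
    have p4: "(\<integral>\<^sup>+x. ennreal (indicator {-R..R} x * norm (F x) ^ 4) \<partial>lborel) = ennreal p"
      unfolding p_def by (rule nn_integral_eq_integral[OF i4]) auto
    have "norm (w x) powr (4/3) = indicator {-R..R} x * norm (F x) ^ 4" for x
    proof -
      have "(norm (F x) ^ 3) powr (4/3) = norm (F x) ^ 4"
        by (cases "F x = 0") (simp_all add: powr_powr flip: powr_numeral)
      then show ?thesis by (simp add: nw indicator_def)
    qed
    then have w43: "(\<integral>\<^sup>+x. ennreal (norm (w x) powr (4/3)) \<partial>lborel) = ennreal p" using p4 by simp
    let ?h = "extension Y T w"
    have hm[measurable]: "?h \<in> borel_measurable borel" by (rule measurable_extension[OF YT wm])
    have joint: "integrable (lborel \<Otimes>\<^sub>M lborel) (\<lambda>(x, \<zeta>). w x * (f \<zeta> * cis (zk_phase x (Y x) (T x) \<zeta>)))"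
      by (rule Bochner_Integration.integrable_bound[OF integrable_tensor[OF w f]])
         (auto simp: norm_mult case_prod_beta')
    have "complex_of_real p = (\<integral>x. w x * F x \<partial>lborel)"
      unfolding wF p_def by (rule integral_complex_of_real[symmetric])
    also have "\<dots> = of_real k * (\<integral>x. \<integral>\<zeta>. w x * (f \<zeta> * cis (zk_phase x (Y x) (T x) \<zeta>)) \<partial>lborel \<partial>lborel)"
      by (simp add: F mult.left_commute[of _ "of_real k"])
    also have "(\<integral>x. \<integral>\<zeta>. w x * (f \<zeta> * cis (zk_phase x (Y x) (T x) \<zeta>)) \<partial>lborel \<partial>lborel)
      = (\<integral>\<zeta>. \<integral>x. w x * (f \<zeta> * cis (zk_phase x (Y x) (T x) \<zeta>)) \<partial>lborel \<partial>lborel)"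
      by (rule lborel_pair.Fubini_integral[symmetric]) (rule joint)
    also have "\<dots> = (\<integral>\<zeta>. f \<zeta> * ?h \<zeta> \<partial>lborel)"
      unfolding extension_def by (simp add: mult.left_commute)
    finally have pint: "complex_of_real p = of_real k * (\<integral>\<zeta>. f \<zeta> * ?h \<zeta> \<partial>lborel)" .
    have fhi: "integrable lborel (\<lambda>\<zeta>. f \<zeta> * ?h \<zeta>)"
      using lborel_pair.integrable_snd[OF joint] unfolding extension_def by (simp add: mult.left_commute)
    have "ennreal p = ennreal (norm (complex_of_real p))" using p by simp
    also have "\<dots> = ennreal k * ennreal (norm (\<integral>\<zeta>. f \<zeta> * ?h \<zeta> \<partial>lborel))"
      unfolding pint using k by (simp add: norm_mult ennreal_mult')
    also have "\<dots> \<le> ennreal k * (\<integral>\<^sup>+\<zeta>. ennreal (norm (f \<zeta> * ?h \<zeta>)) \<partial>lborel)"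
      by (intro mult_left_mono integral_norm_bound_ennreal fhi) auto
    \<comment> \<open>The weight and its inverse are inserted so that Cauchy-Schwarz pairs the H^s
      norm of the datum with the dual weight -s on the extension.\<close>
    also have "(\<integral>\<^sup>+\<zeta>. ennreal (norm (f \<zeta> * ?h \<zeta>)) \<partial>lborel)
       = (\<integral>\<^sup>+\<zeta>. ennreal ((1 + (norm \<zeta>)\<^sup>2) powr (s / 2) * norm (f \<zeta>)) * ennreal ((1 + (norm \<zeta>)\<^sup>2) powr (- s / 2) * norm (?h \<zeta>)) \<partial>lborel)"
    proof (rule nn_integral_cong)
      fix \<zeta> :: "real \<times> (real ^ 'n)"
      have "1 + (norm \<zeta>)\<^sup>2 > 0" by (simp add: add_pos_nonneg)
      then have "(1 + (norm \<zeta>)\<^sup>2) powr (s / 2) * (1 + (norm \<zeta>)\<^sup>2) powr (- s / 2) = 1"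
        unfolding powr_add[symmetric] by simp
      then have "norm (f \<zeta> * ?h \<zeta>) = ((1 + (norm \<zeta>)\<^sup>2) powr (s / 2) * norm (f \<zeta>)) * ((1 + (norm \<zeta>)\<^sup>2) powr (- s / 2) * norm (?h \<zeta>))"
        by (simp add: norm_mult mult.assoc mult.left_commute[of "norm (f \<zeta>)"])
      then show "ennreal (norm (f \<zeta> * ?h \<zeta>)) = ennreal ((1 + (norm \<zeta>)\<^sup>2) powr (s / 2) * norm (f \<zeta>)) * ennreal ((1 + (norm \<zeta>)\<^sup>2) powr (- s / 2) * norm (?h \<zeta>))"
        by (simp only:) (rule ennreal_mult, auto)
    qed
    finally have "(ennreal p)\<^sup>2 \<le> (ennreal k)\<^sup>2 * (\<integral>\<^sup>+\<zeta>. ennreal ((1 + (norm \<zeta>)\<^sup>2) powr (s / 2) * norm (f \<zeta>)) * ennreal ((1 + (norm \<zeta>)\<^sup>2) powr (- s / 2) * norm (?h \<zeta>)) \<partial>lborel)\<^sup>2"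
      unfolding power_mult_distrib[symmetric] by (rule power_mono) simp
    also have "\<dots> \<le> (ennreal k)\<^sup>2 * ((\<integral>\<^sup>+\<zeta>. (ennreal ((1 + (norm \<zeta>)\<^sup>2) powr (s / 2) * norm (f \<zeta>)))\<^sup>2 \<partial>lborel) *
        (\<integral>\<^sup>+\<zeta>. (ennreal ((1 + (norm \<zeta>)\<^sup>2) powr (- s / 2) * norm (?h \<zeta>)))\<^sup>2 \<partial>lborel))"
      by (intro mult_left_mono Cauchy_Schwarz_nn_integral) auto
    also have "(\<integral>\<^sup>+\<zeta>. (ennreal ((1 + (norm \<zeta>)\<^sup>2) powr (s / 2) * norm (f \<zeta>)))\<^sup>2 \<partial>lborel) = ennreal \<sigma>"
      unfolding S[symmetric]
      by (intro nn_integral_cong) (simp add: ennreal_power power_mult_distrib powr_power_nonneg)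
    also have "(\<integral>\<^sup>+\<zeta>. (ennreal ((1 + (norm \<zeta>)\<^sup>2) powr (- s / 2) * norm (?h \<zeta>)))\<^sup>2 \<partial>lborel)
       = (\<integral>\<^sup>+\<zeta>. ennreal ((1 + (norm \<zeta>)\<^sup>2) powr (- s) * (norm (?h \<zeta>))\<^sup>2) \<partial>lborel)"
      by (intro nn_integral_cong) (simp add: ennreal_power power_mult_distrib powr_power_nonneg)
    also have "(ennreal k)\<^sup>2 * (ennreal \<sigma> * \<dots>) \<le> (ennreal k)\<^sup>2 * (ennreal \<sigma> * ennreal (A * p powr (3/2)))"
      by (intro mult_left_mono bound[OF YT w p w43]) auto
    also have "\<dots> = ennreal (k\<^sup>2 * (\<sigma> * (A * p powr (3/2))))"
      using k \<sigma> A by (simp add: ennreal_mult' ennreal_power)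
    also have "(ennreal p)\<^sup>2 = ennreal (p\<^sup>2)" using p by (simp add: ennreal_power)
    finally have p2: "p\<^sup>2 \<le> k\<^sup>2 * (\<sigma> * (A * p powr (3/2)))"
      using \<sigma> A by (simp add: ennreal_le_iff)
    \<comment> \<open>The estimate closes on itself: \<open>p\<close> occurs on both sides of
      \<open>p2\<close>, with exponents 2 and 3/2, and cancelling leaves its square root.\<close>
    have "sqrt p \<le> k\<^sup>2 * A * \<sigma>"
    proof (cases "p = 0")
      case False
      then have pp: "p > 0" using p by simp
      have "p powr (3/2) * sqrt p = p powr (3/2 + 1/2)" using pp by (simp only: powr_add powr_half_sqrt[OF p])
      also have "\<dots> = p\<^sup>2" using pp by simp
      finally have "p powr (3/2) * sqrt p \<le> p powr (3/2) * (k\<^sup>2 * A * \<sigma>)"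
        using p2 by (simp add: mult_ac)
      then show ?thesis using pp by simp
    qed (use \<sigma> A in auto)
    then have "(sqrt p)\<^sup>2 \<le> (k\<^sup>2 * A * \<sigma>)\<^sup>2" using p by (intro power_mono) auto
    then have "p \<le> (k\<^sup>2 * A * \<sigma>)\<^sup>2" using p by simp
    then show "(\<integral>\<^sup>+x. ennreal (indicator {-R..R} x * norm (U (T x) u0 (x, Y x)) ^ 4) \<partial>lborel) \<le> ennreal ((k\<^sup>2 * A * \<sigma>)\<^sup>2)"
      using p4 unfolding F_def by (simp add: ennreal_leI)
  qed
qed

section \<open>Measurable selection of near-maximisers\<close>

text \<open>Dominated convergence, with the modulus of \<open>f\<close> as majorant. Continuity in
  (y, t) allows a countable dense set of parameters to stand in for all of them.\<close>

lemma continuous_zk_integral: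
  fixes f :: "real \<times> 'b::euclidean_space \<Rightarrow> complex"
  assumes f: "integrable lborel f"
  shows "continuous_on UNIV (\<lambda>q. \<integral>\<zeta>. f \<zeta> * cis (zk_phase x (fst q) (snd q) \<zeta>) \<partial>lborel)"
proof -
  have [measurable]: "f \<in> borel_measurable borel" using borel_measurable_integrable[OF f] by simp
  have "isCont (\<lambda>q. \<integral>\<zeta>. f \<zeta> * cis (zk_phase x (fst q) (snd q) \<zeta>) \<partial>lborel) q" for q
  proof (rule continuous_at_sequentiallyI)
    fix u assume u: "u \<longlonglongrightarrow> q"
    show "(\<lambda>n. \<integral>\<zeta>. f \<zeta> * cis (zk_phase x (fst (u n)) (snd (u n)) \<zeta>) \<partial>lborel)
        \<longlonglongrightarrow> (\<integral>\<zeta>. f \<zeta> * cis (zk_phase x (fst q) (snd q) \<zeta>) \<partial>lborel)"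
    proof (rule integral_dominated_convergence[where w = "\<lambda>\<zeta>. norm (f \<zeta>)"])
      show "AE \<zeta> in lborel. (\<lambda>n. f \<zeta> * cis (zk_phase x (fst (u n)) (snd (u n)) \<zeta>))
          \<longlonglongrightarrow> f \<zeta> * cis (zk_phase x (fst q) (snd q) \<zeta>)"
        unfolding zk_phase_def cis_conv_exp using u by (intro AE_I2 tendsto_intros)
    qed (use f in \<open>auto simp: norm_mult\<close>)
  qed
  then show ?thesis by (simp add: continuous_on_eq_continuous_at)
qed

text \<open>A maximum over finitely many candidates is attained and is found by comparisons alone,
  so the maximiser depends measurably on x. Over all (y, t) a maximiser need not exist.\<close>

fun running_argmax :: "('a \<Rightarrow> 'b \<Rightarrow> real) \<Rightarrow> (nat \<Rightarrow> 'b) \<Rightarrow> nat \<Rightarrow> 'a \<Rightarrow> 'b" where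
  "running_argmax g q 0 x = q 0"
| "running_argmax g q (Suc m) x =
    (if g x (running_argmax g q m x) < g x (q (Suc m)) then q (Suc m) else running_argmax g q m x)"

lemma running_argmax_mono: "m \<le> m' \<Longrightarrow> g x (running_argmax g q m x) \<le> g x (running_argmax g q m' x)"
  by (induction m' rule: dec_induct) (auto intro: order_trans less_imp_le)

lemma running_argmax_ge: "l \<le> m \<Longrightarrow> g x (q l) \<le> g x (running_argmax g q m x)"
  by (rule order_trans[OF _ running_argmax_mono[of l m]]) (cases l; auto)

text \<open>Maxima over initial segments of a dense sequence increase to a function dominating the
  supremum. Each of them is covered by the linearised estimate with one and the same constant, and
  monotone convergence passes to the limit.\<close>

lemma maximal_estimate:
  assumes dim: "CARD('n::finite) \<ge> 2" and s: "s > (CARD('n) + 1) / 2 - 1 / 4"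
  shows "\<exists>C\<ge>0. \<forall>(u0 :: real \<times> (real ^ 'n) \<Rightarrow> complex) \<sigma>. integrable lborel (fourier u0) \<longrightarrow> \<sigma> \<ge> 0 \<longrightarrow>
      (\<integral>\<^sup>+\<zeta>. ennreal ((1 + (norm \<zeta>)\<^sup>2) powr s * (norm (fourier u0 \<zeta>))\<^sup>2) \<partial>lborel) = ennreal \<sigma> \<longrightarrow>
      (\<integral>\<^sup>+x. (SUP y. SUP t. ennreal (norm (U t u0 (x, y)) ^ 4)) \<partial>lborel) \<le> ennreal ((C * \<sigma>)\<^sup>2)"
proof -
  obtain C where C: "C \<ge> 0" and bound: "\<And>(u0 :: real \<times> (real ^ 'n) \<Rightarrow> complex) Y T R \<sigma>. integrable lborel (fourier u0) \<Longrightarrow>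
      Y \<in> borel_measurable borel \<Longrightarrow> T \<in> borel_measurable borel \<Longrightarrow> \<sigma> \<ge> 0 \<Longrightarrow>
      (\<integral>\<^sup>+\<zeta>. ennreal ((1 + (norm \<zeta>)\<^sup>2) powr s * (norm (fourier u0 \<zeta>))\<^sup>2) \<partial>lborel) = ennreal \<sigma> \<Longrightarrow>
      (\<integral>\<^sup>+x. ennreal (indicator {-R..R} x * norm (U (T x) u0 (x, Y x)) ^ 4) \<partial>lborel) \<le> ennreal ((C * \<sigma>)\<^sup>2)"
    using linearized_maximal_estimate[OF dim s] by blast
  show ?thesis
  proof (intro exI[of _ C] conjI allI impI C)
    fix u0 :: "real \<times> (real ^ 'n) \<Rightarrow> complex" and \<sigma> :: real
    assume f: "integrable lborel (fourier u0)" and \<sigma>: "\<sigma> \<ge> 0"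
      and S: "(\<integral>\<^sup>+\<zeta>. ennreal ((1 + (norm \<zeta>)\<^sup>2) powr s * (norm (fourier u0 \<zeta>))\<^sup>2) \<partial>lborel) = ennreal \<sigma>"
    have [measurable]: "fourier u0 \<in> borel_measurable borel" using borel_measurable_integrable[OF f] by simp
    define g where "g x q = norm (U (snd q) u0 (x, fst q))" for x and q :: "(real ^ 'n) \<times> real"
    have g_cont: "continuous_on UNIV (g x)" for x
      unfolding g_def U_eq_integral by (intro continuous_intros continuous_zk_integral f)
    obtain D :: "((real ^ 'n) \<times> real) set" where D: "countable D" "\<And>X. open X \<Longrightarrow> X \<noteq> {} \<Longrightarrow> \<exists>d\<in>D. d \<in> X"
      by (rule countable_dense_setE) blast
    define q where "q = from_nat_into D"
    have "D \<noteq> {}" using D(2)[of UNIV] by auto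
    then have q: "range q = D" using D(1) by (simp add: q_def range_from_nat_into)
    define Q where "Q = running_argmax g q"
    have Qm: "Q m \<in> borel_measurable borel" for m
    proof (induction m)
      case 0
      have "Q 0 = (\<lambda>_. q 0)" by (simp add: Q_def fun_eq_iff)
      then show ?case by simp
    next
      case (Suc m)
      note [measurable] = Suc
      have "Q (Suc m) = (\<lambda>x. if g x (Q m x) < g x (q (Suc m)) then q (Suc m) else Q m x)"
        by (simp add: Q_def fun_eq_iff)
      also have "\<dots> \<in> borel_measurable borel"
        unfolding g_def U_eq_integral by measurable
      finally show ?case .
    qed
    \<comment> \<open>One index governs both the window in x and the number of candidates, so
      \<open>G\<close> increases in m.\<close>
    define G where "G m x = ennreal (indicator {- real m..real m} x * g x (Q m x) ^ 4)" for m x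
    have g0: "g x z \<ge> 0" for x z by (simp add: g_def)
    have G_inc: "G m x \<le> G m' x" if "m \<le> m'" for m m' x
      unfolding G_def Q_def
      by (intro ennreal_leI mult_mono power_mono running_argmax_mono that)
         (use that in \<open>auto simp: indicator_def g0\<close>)
    have G_m[measurable]: "G m \<in> borel_measurable borel" for m
    proof -
      note [measurable] = Qm[of m]
      show ?thesis unfolding G_def g_def U_eq_integral by measurable
    qed
    have ptw: "(SUP y. SUP t. ennreal (norm (U t u0 (x, y)) ^ 4)) \<le> (SUP m. G m x)" for x
    proof (intro SUP_least)
      fix y t
      show "ennreal (norm (U t u0 (x, y)) ^ 4) \<le> (SUP m. G m x)"
      proof (rule ccontr)
        assume "\<not> ?thesis"
        then have less: "(SUP m. G m x) < ennreal (g x (y, t) ^ 4)" by (simp add: g_def)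
        then obtain b where b: "b \<ge> 0" "(SUP m. G m x) = ennreal b"
          by (cases "SUP m. G m x") auto
        have "open {z. b < g x z ^ 4}"
          by (intro open_Collect_less continuous_intros g_cont)
        moreover have "(y, t) \<in> {z. b < g x z ^ 4}" using less b by (simp add: ennreal_less_iff)
        ultimately obtain l where l: "b < g x (q l) ^ 4"
          using D(2)[of "{z. b < g x z ^ 4}"] q by blast
        \<comment> \<open>Large enough that \<open>q l\<close> is among the candidates and x lies in
          the window.\<close>
        define m where "m = max l (nat \<lceil>\<bar>x\<bar>\<rceil>)"
        have "x \<in> {- real m..real m}" unfolding m_def by (auto simp: abs_le_iff[symmetric]) linarith+
        then have "G m x = ennreal (g x (Q m x) ^ 4)" by (simp add: G_def)
        also have "\<dots> \<ge> ennreal (g x (q l) ^ 4)"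
          unfolding Q_def by (intro ennreal_leI power_mono running_argmax_ge g0) (simp add: m_def)
        finally have "ennreal (g x (q l) ^ 4) \<le> (SUP m. G m x)" by (rule SUP_upper2[rotated]) simp
        then show False using l b by (simp add: ennreal_le_iff)
      qed
    qed
    have "(\<integral>\<^sup>+x. (SUP y. SUP t. ennreal (norm (U t u0 (x, y)) ^ 4)) \<partial>lborel) \<le> (\<integral>\<^sup>+x. (SUP m. G m x) \<partial>lborel)"
      by (intro nn_integral_mono ptw)
    also have "\<dots> = (SUP m. \<integral>\<^sup>+x. G m x \<partial>lborel)"
      by (rule nn_integral_monotone_convergence_SUP) (auto simp: incseq_def le_fun_def G_inc)
    also have "\<dots> \<le> ennreal ((C * \<sigma>)\<^sup>2)"
    proof (rule SUP_least)
      fix m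
      note [measurable] = Qm[of m]
      have "(\<lambda>x. fst (Q m x)) \<in> borel_measurable borel" "(\<lambda>x. snd (Q m x)) \<in> borel_measurable borel"
        by measurable
      from bound[OF f this \<sigma> S, of "real m"]
      show "(\<integral>\<^sup>+x. G m x \<partial>lborel) \<le> ennreal ((C * \<sigma>)\<^sup>2)" unfolding G_def g_def .
    qed
    finally show "(\<integral>\<^sup>+x. (SUP y. SUP t. ennreal (norm (U t u0 (x, y)) ^ 4)) \<partial>lborel) \<le> ennreal ((C * \<sigma>)\<^sup>2)" .
  qed
qed

theorem proposition3p4:
  fixes d :: nat and s :: real
  assumes "d = CARD('n::finite) + 1"
    and "d \<ge> 3"
    and "s > real d / 2 - 1 / 4"
  shows "\<exists>C::real. C \<ge> 0 \<and>
    (\<forall>u0 :: real \<times> (real ^ 'n) \<Rightarrow> complex. schwartz u0 \<longrightarrow>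
       L4x_Linf_yt_norm (\<lambda>x y t. U t u0 (x, y)) \<le> ennreal C * sobolev_norm s u0)"
proof -
  have "CARD('n) \<ge> 2" "s > (CARD('n) + 1) / 2 - 1 / 4" using assms by auto
  from maximal_estimate[OF this]
  obtain C where C: "C \<ge> 0" and bound: "\<And>(u0 :: real \<times> (real ^ 'n) \<Rightarrow> complex) \<sigma>. integrable lborel (fourier u0) \<Longrightarrow> \<sigma> \<ge> 0 \<Longrightarrow>
      (\<integral>\<^sup>+\<zeta>. ennreal ((1 + (norm \<zeta>)\<^sup>2) powr s * (norm (fourier u0 \<zeta>))\<^sup>2) \<partial>lborel) = ennreal \<sigma> \<Longrightarrow>
      (\<integral>\<^sup>+x. (SUP y. SUP t. ennreal (norm (U t u0 (x, y)) ^ 4)) \<partial>lborel) \<le> ennreal ((C * \<sigma>)\<^sup>2)"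
    by blast
  show ?thesis
  \<comment> \<open>The summand 1 makes the constant positive even if \<open>C\<close> is 0, so that
    its product with an infinite Sobolev norm is \<open>top\<close> and not 0.\<close>
  proof (intro exI[of _ "sqrt C + 1"] conjI allI impI)
    show "sqrt C + 1 \<ge> 0" using C by simp
    fix u0 :: "real \<times> (real ^ 'n) \<Rightarrow> complex"
    define S where "S = (\<integral>\<^sup>+\<zeta>. ennreal ((1 + (norm \<zeta>)\<^sup>2) powr s * (norm (fourier u0 \<zeta>))\<^sup>2) \<partial>lborel)"
    have sob: "sobolev_norm s u0 = ennroot 2 S" by (simp add: sobolev_norm_def S_def)
    consider "\<not> integrable lborel (fourier u0)" | "S = top" | \<sigma> where "integrable lborel (fourier u0)" "\<sigma> \<ge> 0" "S = ennreal \<sigma>"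
      by (cases S) auto
    then show "L4x_Linf_yt_norm (\<lambda>x y t. U t u0 (x, y)) \<le> ennreal (sqrt C + 1) * sobolev_norm s u0"
    proof cases
      case 1
      then show ?thesis by (simp add: L4x_Linf_yt_norm_def U_eq_0 ennroot_def)
    next
      case 2
      have "sqrt C + 1 > 0" using C by (simp add: add_nonneg_pos)
      then show ?thesis unfolding sob 2 ennroot_def by (simp add: ennreal_mult_top)
    next
      case 3
      let ?X = "\<integral>\<^sup>+x. (SUP y. SUP t. ennreal (norm (U t u0 (x, y)) ^ 4)) \<partial>lborel"
      have X: "?X \<le> ennreal ((C * \<sigma>)\<^sup>2)" using bound[OF 3(1,2)] 3(3) by (simp add: S_def)
      then have "?X \<noteq> top" by (auto simp: top_unique)
      have "root 4 (enn2real ?X) \<le> root 4 ((C * \<sigma>)\<^sup>2)"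
        using X by (intro real_root_le_mono enn2real_leI) auto
      \<comment> \<open>\<sigma> is the square of the Sobolev norm, so the fourth root is linear in
        that norm.\<close>
      also have "(C * \<sigma>)\<^sup>2 = (sqrt C * sqrt \<sigma>) ^ 4"
        using C 3(2) power_mult[of "sqrt C * sqrt \<sigma>" 2 2] by (simp add: power_mult_distrib)
      also have "root 4 \<dots> = sqrt C * sqrt \<sigma>" using C 3(2) by (intro real_root_power_cancel) auto
      also have "\<dots> \<le> (sqrt C + 1) * sqrt \<sigma>" using 3(2) by (intro mult_right_mono) auto
      finally have "ennreal (root 4 (enn2real ?X)) \<le> ennreal ((sqrt C + 1) * sqrt \<sigma>)" by (rule ennreal_leI)
      also have "\<dots> = ennreal (sqrt C + 1) * ennreal (sqrt \<sigma>)"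
        using C by (intro ennreal_mult') simp
      finally show ?thesis
        using \<open>?X \<noteq> top\<close> 3 by (simp add: sob L4x_Linf_yt_norm_def ennroot_def sqrt_def)
    qed
  qed
qed

end
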